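(* Let $t\ge2$, let $a_1<a_2<\cdots<a_t$ be integers and $f(x)=c_1x^{a_1}+c_2x^{a_2}+\cdots+c_tx^{a_t}$ with i.i.d. uniformly distributed coefficients $c_j$ in $R$. For $U\subseteq K^\times$ let $N_U(f)$ denote the number of nondegenerate zeros of $f$ in $U$. Then $$\mathbb{E}(N_{R^\times}(f))=\frac{1-\varepsilon}{1+\varepsilon}\cdot\max_{j\ge2}|a_j-a_1|,\qquad \mathbb{E}(N_{\mathfrak{m}\setminus\{0\}}(f))\le\frac{1-\varepsilon}{1+\varepsilon}\Big((1-\varepsilon^{a_2-a_1})^{-1}-1\Big),$$ with equality in the latter if $|a_2-a_1|=1$. Moreover, $$\mathbb{E}(N_{K^\times}(f))\le\frac{1-\varepsilon}{1+\varepsilon}\Big((1-\varepsilon^{a_2-a_1})^{-1}+(1-\varepsilon^{a_t-a_{t-1}})^{-1}-1\Big),$$ with equality if $|a_2-a_1|=1$ and $|a_t-a_{t-1}|=1$. In particular, $\mathbb{E}(N_{K^\times}(f))\le1$. Here $|a_i-a_j|$ denotes the absolute value in $K$ of the integer $a_i-a_j$, while the exponents of $\varepsilon$ are ordinary integers.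
   Context: $K$ is a nonarchimedean local field of characteristic zero with valuation ring $R$, maximal ideal $\mathfrak{m}$, uniformizer $\varpi$, residue field of cardinality $q$, $\varepsilon=q^{-1}$, and the absolute value of $K$ normalized by $|\varpi|=\varepsilon$. "Uniformly distributed in $R$" refers to the normalized Haar measure on $R$. A zero $x$ of $f$ is nondegenerate if $f'(x)\ne0$. *)

theory Defs
  imports "HOL-Probability.Probability" "HOL-Computational_Algebra.Polynomial"
begin

class ultrametric_abs = field + metric_space +
  fixes absv :: "'a \<Rightarrow> real"
  assumes dist_absv: "dist x y = absv (x - y)"
    and absv_mult: "absv (x * y) = absv x * absv y"
    and absv_ultrametric: "absv (x + y) \<le> max (absv x) (absv y)"

definition (in ultrametric_abs) valuation_ring :: "'a set"
  where "valuation_ring = {x. absv x \<le> 1}"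

definition (in ultrametric_abs) maximal_ideal :: "'a set"
  where "maximal_ideal = {x. absv x < 1}"

definition (in ultrametric_abs) residue_field :: "'a set set"
  where "residue_field =
    valuation_ring // {(x, y). x \<in> valuation_ring \<and> y \<in> valuation_ring \<and> x - y \<in> maximal_ideal}"

definition (in ultrametric_abs) uniformizer :: "'a \<Rightarrow> bool"
  where "uniformizer \<pi> \<longleftrightarrow> \<pi> \<noteq> 0 \<and> maximal_ideal = (*) \<pi> ` valuation_ring"

text \<open>
  Nonarchimedean local fields of characteristic zero: complete with respect to a nontrivial
  discrete absolute value, with finite residue field. The existence of a uniformizer expresses
  both nontriviality and discreteness.
\<close>

class nonarch_local_field_0 = ultrametric_abs + field_char_0 + complete_space +
  assumes ex_uniformizer: "\<exists>\<pi>::'a. uniformizer \<pi>"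
    and finite_residue_field: "finite (residue_field :: 'a set set)"
    and absv_uniformizer: "uniformizer \<pi> \<Longrightarrow> absv \<pi> = 1 / real (card (residue_field :: 'a set set))"

definition residue_card :: "'a::ultrametric_abs itself \<Rightarrow> nat"
  where "residue_card _ = card (residue_field :: 'a set set)"

definition valuation_ring_units :: "'a::ultrametric_abs set"
  where "valuation_ring_units =
    {x \<in> valuation_ring. x \<noteq> 0 \<and> inverse x \<in> valuation_ring}"

text \<open>
  The normalized Haar measure of the compact group \<open>(valuation_ring, +)\<close>, as a measure whose
  space is the valuation ring. Being a finite Borel measure on a compact metric space, it is
  automatically regular.
\<close>

definition normalized_Haar_measure :: "'a::ultrametric_abs measure \<Rightarrow> bool"
  where "normalized_Haar_measure \<mu> \<longleftrightarrow>
    prob_space \<mu> \<and>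
    space \<mu> = valuation_ring \<and>
    sets \<mu> = sets (restrict_space borel valuation_ring) \<and>
    (\<forall>a\<in>valuation_ring. distr \<mu> \<mu> (\<lambda>x. a + x) = \<mu>)"

definition iid_uniform :: "'w measure \<Rightarrow> 'i set \<Rightarrow> ('i \<Rightarrow> 'w \<Rightarrow> 'a) \<Rightarrow>
    'a::ultrametric_abs measure \<Rightarrow> bool"
  where "iid_uniform M I c \<mu> \<longleftrightarrow>
    prob_space.indep_vars M (\<lambda>_. \<mu>) c I \<and> (\<forall>j\<in>I. distr M \<mu> (c j) = \<mu>)"

definition laurent_eval :: "nat \<Rightarrow> (nat \<Rightarrow> int) \<Rightarrow> (nat \<Rightarrow> 'a::field) \<Rightarrow> 'a \<Rightarrow> 'a"
  where "laurent_eval t a c x = (\<Sum>j=1..t. c j * x powi a j)"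

text \<open>The formal derivative: \<open>has_field_derivative\<close> is only available over real normed fields.\<close>

definition laurent_deriv :: "nat \<Rightarrow> (nat \<Rightarrow> int) \<Rightarrow> (nat \<Rightarrow> 'a::field) \<Rightarrow> 'a \<Rightarrow> 'a"
  where "laurent_deriv t a c x = (\<Sum>j=1..t. c j * of_int (a j) * x powi (a j - 1))"

definition nondeg_zeros :: "'a set \<Rightarrow> nat \<Rightarrow> (nat \<Rightarrow> int) \<Rightarrow> (nat \<Rightarrow> 'a::field) \<Rightarrow> 'a set"
  where "nondeg_zeros U t a c = {x \<in> U. laurent_eval t a c x = 0 \<and> laurent_deriv t a c x \<noteq> 0}"

definition num_nondeg_zeros :: "'a set \<Rightarrow> nat \<Rightarrow> (nat \<Rightarrow> int) \<Rightarrow> (nat \<Rightarrow> 'a::field) \<Rightarrow> nat"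
  where "num_nondeg_zeros U t a c = card (nondeg_zeros U t a c)"

text \<open>
  For \<open>U\<close> not containing 0 the set counted by \<^const>\<open>num_nondeg_zeros\<close> is finite, so \<^const>\<open>card\<close>
  does not return its default value for infinite sets.
\<close>

lemma finite_nondeg_zeros:
  fixes c :: "nat \<Rightarrow> 'a::field"
  assumes "strict_mono_on {1..t} a" and "0 \<notin> U"
  shows "finite (nondeg_zeros U t a c)"
proof (cases "\<forall>j\<in>{1..t}. c j = 0")
  case True
  then have "nondeg_zeros U t a c = {}"
    by (auto simp: nondeg_zeros_def laurent_deriv_def)
  then show ?thesis by simp
next
  case False
  then obtain k where k: "k \<in> {1..t}" "c k \<noteq> 0" by blast
  define p where "p = (\<Sum>j=1..t. monom (c j) (nat (a j - a 1)))"
  have le: "a 1 \<le> a j" if "j \<in> {1..t}" for j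
    using strict_mono_on_leD[OF assms(1), of 1 j] that by auto
  have inj: "nat (a j - a 1) = nat (a k - a 1) \<longleftrightarrow> j = k" if "j \<in> {1..t}" for j
  proof -
    have "nat (a j - a 1) = nat (a k - a 1) \<longleftrightarrow> a j = a k"
      using le[OF that] le[OF k(1)] by linarith
    also have "\<dots> \<longleftrightarrow> j = k"
      using strict_mono_on_imp_inj_on[OF assms(1)] that k(1) by (rule inj_on_eq_iff)
    finally show ?thesis .
  qed
  have "coeff p (nat (a k - a 1)) = (\<Sum>j=1..t. if j = k then c j else 0)"
    unfolding p_def coeff_sum coeff_monom by (intro sum.cong refl) (simp only: inj)
  also have "\<dots> = c k" using k by simp
  finally have "p \<noteq> 0" using k by auto
  have root: "poly p x = 0" if "x \<noteq> 0" "laurent_eval t a c x = 0" for x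
  proof -
    have "laurent_eval t a c x = (\<Sum>j=1..t. x powi a 1 * (c j * x ^ nat (a j - a 1)))"
      unfolding laurent_eval_def
    proof (intro sum.cong refl)
      fix j assume "j \<in> {1..t}"
      then have "a j = a 1 + int (nat (a j - a 1))"
        using le[of j] by simp
      then have "x powi a j = x powi a 1 * x powi int (nat (a j - a 1))"
        using that(1) by (metis power_int_add)
      then have "x powi a j = x powi a 1 * x ^ nat (a j - a 1)"
        by (simp only: power_int_of_nat)
      then show "c j * x powi a j = x powi a 1 * (c j * x ^ nat (a j - a 1))" by simp
    qed
    also have "\<dots> = x powi a 1 * poly p x"
      by (simp add: p_def poly_sum poly_monom sum_distrib_left)
    finally show ?thesis using that by simp
  qed
  have "nondeg_zeros U t a c \<subseteq> {x. poly p x = 0}"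
  proof
    fix x assume "x \<in> nondeg_zeros U t a c"
    then have "x \<in> U" and zero: "laurent_eval t a c x = 0"
      by (simp_all add: nondeg_zeros_def)
    then have "x \<noteq> 0" using assms(2) by metis
    then show "x \<in> {x. poly p x = 0}" using root[OF _ zero] by simp
  qed
  then show ?thesis
    using poly_roots_finite[OF \<open>p \<noteq> 0\<close>] by (rule finite_subset)
qed

end

theory Submission
  imports Defs
begin

text \<open>
  The expectation is computed by an elementary Kac-Rice argument in which every integral is a
  finite count of balls.

  Consider first the unit sphere and a Laurent polynomial \<open>G(x) = c\<^sub>i + (\<Sum>j\<noteq>i. c\<^sub>j w\<^sub>j x\<^bsup>b\<^sub>j\<^esup>)\<close> with
  \<open>b\<^sub>i = 0\<close>, \<open>w\<^sub>i = 1\<close> and all \<open>|w\<^sub>j| \<le> 1\<close>. Since the coefficients are integral, \<open>G\<close> agrees on units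
  with its linear Taylor polynomial up to an error \<open>|y - x|\<^sup>2\<close>. Cover the units by balls of radius
  \<open>\<epsilon>\<^bsup>m+1\<^esup>\<close>, with centres \<open>x\<close>. By Hensel's lemma such a ball contains a zero \<open>z\<close> with
  \<open>|G'(z)| = \<epsilon>\<^sup>m\<close> if and only if \<open>|G'(x)| = \<epsilon>\<^sup>m\<close> and \<open>|G(x)| \<le> \<epsilon>\<^bsup>2m+1\<^esup>\<close>, and that zero is unique
  (\<open>card_unit_zeros_of_slope\<close>). Now \<open>G'\<close> does not involve the pivot coefficient \<open>c\<^sub>i\<close>, while
  \<open>G(x)\<close> is \<open>c\<^sub>i\<close> plus an integral quantity independent of it. The Haar measure is translation
  invariant, so the condition on \<open>G(x)\<close> has conditional probability \<open>\<epsilon>\<^bsup>2m+1\<^esup>\<close> (\<open>prob_pivot\<close>). There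
  are \<open>(1 - \<epsilon>) \<epsilon>\<^bsup>-(m+1)\<^esup>\<close> balls, so zeros of slope \<open>\<epsilon>\<^sup>m\<close> contribute \<open>(1 - \<epsilon>) \<epsilon>\<^sup>m P(|G'(x)| = \<epsilon>\<^sup>m)\<close>,
  and the total is \<open>(1 - \<epsilon>) E|G'(x)|\<close>. For the linear form \<open>G'(x)\<close> in the coefficients,
  \<open>|G'(x)|\<close> is distributed like \<open>\<beta> |c|\<close> with \<open>c\<close> uniform (\<open>prob_linear_form_eq\<close>), where \<open>\<beta>\<close> is the
  largest \<open>|w\<^sub>j b\<^sub>j|\<close> with \<open>j \<noteq> i\<close>, so \<open>E|G'(x)| = \<beta> / (1 + \<epsilon>)\<close>. This is \<open>expected_unit_zeros\<close>.

  On the sphere \<open>|x| = \<epsilon>\<^sup>k\<close> substitute \<open>x = \<pi>\<^sup>k u\<close> and divide by \<open>(\<pi>\<^sup>k u)\<^bsup>a\<^sub>i\<^esup>\<close>. The result has the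
  above form with \<open>|w\<^sub>j| = \<epsilon>\<^bsup>k(a\<^sub>j - a\<^sub>i)\<^esup>\<close>, provided the pivot \<open>i\<close> is the first index for \<open>k \<ge> 0\<close> and
  the last one for \<open>k < 0\<close>. For \<open>k = 0\<close> this is the formula on the units. For \<open>k > 0\<close> the maximum
  is at most \<open>\<epsilon>\<^bsup>k(a\<^sub>2 - a\<^sub>1)\<^esup>\<close>, with equality if \<open>|a\<^sub>2 - a\<^sub>1| = 1\<close>, and similarly for \<open>k < 0\<close> with the
  last gap. Summing two geometric series (\<open>expected_zeros_one_side\<close>) gives the remaining claims.
\<close>

section \<open>Ultrametric absolute values\<close>

lemma absv_0 [simp]: "absv (0::'a::ultrametric_abs) = 0"
  using dist_absv[of "0::'a" 0] by simp

lemma absv_nonneg [simp]: "0 \<le> absv (x::'a::ultrametric_abs)"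
  using dist_absv[of x 0] by (metis diff_zero zero_le_dist)

lemma absv_eq_0_iff [simp]: "absv x = 0 \<longleftrightarrow> x = (0::'a::ultrametric_abs)"
  using dist_absv[of x 0] by (metis diff_zero dist_eq_0_iff)

lemma absv_pos_iff [simp]: "0 < absv x \<longleftrightarrow> x \<noteq> (0::'a::ultrametric_abs)"
  using absv_nonneg[of x] absv_eq_0_iff[of x] by linarith

lemma absv_1 [simp]: "absv (1::'a::ultrametric_abs) = 1"
  using absv_mult[of "1::'a" 1] absv_eq_0_iff[of "1::'a"] by simp

lemma absv_minus [simp]: "absv (- x) = absv (x::'a::ultrametric_abs)"
  using dist_absv[of x 0] dist_absv[of 0 x] by (simp add: dist_commute)

lemma absv_minus_commute: "absv (x - y) = absv (y - x :: 'a::ultrametric_abs)"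
  using absv_minus[of "x - y"] by simp

lemma absv_inverse [simp]: "absv (inverse x) = inverse (absv (x::'a::ultrametric_abs))"
proof (cases "x = 0")
  case False
  then have "absv x * absv (inverse x) = 1"
    by (simp flip: absv_mult)
  then show ?thesis
    by (metis inverse_unique)
qed simp

lemma absv_divide: "absv (x / y) = absv x / absv (y::'a::ultrametric_abs)"
  by (simp add: divide_inverse absv_mult)

lemma absv_power: "absv (x ^ n) = absv (x::'a::ultrametric_abs) ^ n"
  by (induction n) (simp_all add: absv_mult)

lemma absv_power_int: "absv (x powi n) = absv (x::'a::ultrametric_abs) powi n"
  by (cases "n \<ge> 0") (simp_all add: power_int_def absv_power)

lemma absv_add_le: "absv x \<le> r \<Longrightarrow> absv y \<le> r \<Longrightarrow> absv (x + y :: 'a::ultrametric_abs) \<le> r"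
  using absv_ultrametric[of x y] by linarith

lemma absv_diff_le: "absv x \<le> r \<Longrightarrow> absv y \<le> r \<Longrightarrow> absv (x - y :: 'a::ultrametric_abs) \<le> r"
  using absv_add_le[of x r "- y"] by simp

lemma absv_add_eq:
  "absv y < absv x \<Longrightarrow> absv (x + y :: 'a::ultrametric_abs) = absv x"
  using absv_ultrametric[of x y] absv_ultrametric[of "x + y" "- y"] by simp

text \<open>In an ultrametric, being closer to \<open>x\<close> than \<open>x\<close> is to zero preserves the absolute value.\<close>

lemma absv_eq_of_close:
  "absv (y - x) < absv x \<Longrightarrow> absv (y :: 'a::ultrametric_abs) = absv x"
  using absv_add_eq[of "y - x" x] by simp

lemma absv_sum_le:
  fixes f :: "'i \<Rightarrow> 'a::ultrametric_abs"
  assumes "0 \<le> r" "\<And>i. i \<in> I \<Longrightarrow> absv (f i) \<le> r"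
  shows "absv (sum f I) \<le> r"
  using assms by (induction I rule: infinite_finite_induct) (auto intro: absv_add_le)

lemma absv_of_nat_le_1: "absv (of_nat n :: 'a::ultrametric_abs) \<le> 1"
  by (induction n) (auto intro: absv_add_le)

lemma absv_of_int_le_1: "absv (of_int n :: 'a::ultrametric_abs) \<le> 1"
  by (cases n) (auto simp: absv_of_nat_le_1 simp del: of_nat_Suc)

section \<open>Taylor expansion of Laurent polynomials on the unit sphere\<close>

text \<open>The remainder
  \<open>E\<^sub>n = y\<^sup>n - x\<^sup>n - n x\<^bsup>n-1\<^esup> (y - x)\<close> satisfies \<open>E\<^bsub>n+1\<^esub> = y E\<^sub>n + n x\<^bsup>n-1\<^esup> (y - x)\<^sup>2\<close>, which can be read
  in both directions because \<open>y\<close> is a unit.\<close>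

lemma powi_taylor:
  fixes x y :: "'a::ultrametric_abs" and n :: int
  assumes x: "absv x = 1" and y: "absv y = 1"
  shows "absv (y powi n - x powi n - of_int n * x powi (n - 1) * (y - x)) \<le> absv (y - x) ^ 2"
proof -
  have nz: "x \<noteq> 0" "y \<noteq> 0" using x y by auto
  define E where "E n = y powi n - x powi n - of_int n * x powi (n - 1) * (y - x)" for n :: int
  have step: "E (n + 1) = y * E n + of_int n * x powi (n - 1) * (y - x)^2" for n
  proof -
    have "x powi (n + 1) = x powi (n - 1) * x * x" "x powi n = x powi (n - 1) * x"
      "y powi (n + 1) = y powi n * y"
      using nz power_int_add_1[of x n] power_int_add_1[of y n] power_int_add_1[of x "n - 1"]
      by auto
    then show ?thesis
      unfolding E_def by (simp add: power2_eq_square algebra_simps)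
  qed
  have aux: "absv (of_int n * x powi (n - 1) * (y - x)^2) \<le> absv (y - x)^2" for n :: int
    using mult_right_mono[OF absv_of_int_le_1[of n, where 'a = 'a], of "absv (y - x)^2"]
    by (simp add: absv_mult absv_power absv_power_int x)
  have "absv (E n) \<le> absv (y - x)^2"
  proof (induction n rule: int_induct[where k = 0])
    case base
    then show ?case by (simp add: E_def)
  next
    case (step1 i)
    then show ?case
      unfolding step by (intro absv_add_le aux) (simp add: absv_mult y)
  next
    case (step2 i)
    have "y * E (i - 1) = E i - of_int (i - 1) * x powi (i - 1 - 1) * (y - x)^2"
      using step[of "i - 1"] by simp
    also have "absv \<dots> \<le> absv (y - x)^2"
      by (intro absv_diff_le step2 aux)
    finally show ?case by (simp add: absv_mult y)
  qed
  then show ?thesis unfolding E_def .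
qed

lemma powi_lipschitz:
  fixes x y :: "'a::ultrametric_abs" and n :: int
  assumes x: "absv x = 1" and y: "absv y = 1"
  shows "absv (y powi n - x powi n) \<le> absv (y - x)"
proof -
  define d where "d = absv (y - x)"
  have d: "0 \<le> d" "d \<le> 1" using absv_diff_le[of y 1 x] x y by (auto simp: d_def)
  have "d^2 \<le> d" using d by (simp add: power2_eq_square mult_left_le_one_le)
  moreover have "absv (of_int n * x powi (n - 1) * (y - x)) \<le> d"
    using mult_right_mono[OF absv_of_int_le_1[of n, where 'a = 'a], of d]
    by (simp add: absv_mult absv_power_int x d_def)
  ultimately show ?thesis
    using powi_taylor[OF x y, of n]
      absv_add_le[of "y powi n - x powi n - of_int n * x powi (n - 1) * (y - x)" d
        "of_int n * x powi (n - 1) * (y - x)"]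
    by (simp add: d_def)
qed

lemma laurent_taylor:
  fixes c :: "nat \<Rightarrow> 'a::ultrametric_abs"
  assumes x: "absv x = 1" and y: "absv y = 1" and c: "\<forall>j\<in>{1..t}. absv (c j) \<le> 1"
  shows "absv (laurent_eval t b c y - laurent_eval t b c x - laurent_deriv t b c x * (y - x))
    \<le> absv (y - x) ^ 2"
proof -
  have "laurent_eval t b c y - laurent_eval t b c x - laurent_deriv t b c x * (y - x) =
    (\<Sum>j=1..t. c j * (y powi b j - x powi b j - of_int (b j) * x powi (b j - 1) * (y - x)))"
    unfolding laurent_eval_def laurent_deriv_def
    by (simp add: sum_distrib_right sum_subtractf right_diff_distrib mult.assoc)
  also have "absv \<dots> \<le> absv (y - x)^2"
  proof (intro absv_sum_le)
    fix j assume "j \<in> {1..t}"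
    then show "absv (c j * (y powi b j - x powi b j - of_int (b j) * x powi (b j - 1) * (y - x)))
        \<le> absv (y - x)^2"
      using mult_mono[OF bspec[OF c] powi_taylor[OF x y]] by (simp add: absv_mult)
  qed simp
  finally show ?thesis .
qed

lemma laurent_deriv_lipschitz:
  fixes c :: "nat \<Rightarrow> 'a::ultrametric_abs"
  assumes x: "absv x = 1" and y: "absv y = 1" and c: "\<forall>j\<in>{1..t}. absv (c j) \<le> 1"
  shows "absv (laurent_deriv t b c y - laurent_deriv t b c x) \<le> absv (y - x)"
proof -
  have "laurent_deriv t b c y - laurent_deriv t b c x =
    (\<Sum>j=1..t. c j * of_int (b j) * (y powi (b j - 1) - x powi (b j - 1)))"
    unfolding laurent_deriv_def by (simp add: sum_subtractf algebra_simps)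
  also have "absv \<dots> \<le> absv (y - x)"
  proof (intro absv_sum_le)
    fix j assume "j \<in> {1..t}"
    then show "absv (c j * of_int (b j) * (y powi (b j - 1) - x powi (b j - 1))) \<le> absv (y - x)"
      using mult_mono[OF mult_mono[OF bspec[OF c] absv_of_int_le_1[of "b j"]] powi_lipschitz[OF x y]]
      by (simp add: absv_mult)
  qed simp
  finally show ?thesis .
qed

lemma laurent_deriv_le_1:
  fixes c :: "nat \<Rightarrow> 'a::ultrametric_abs"
  assumes x: "absv x = 1" and c: "\<forall>j\<in>{1..t}. absv (c j) \<le> 1"
  shows "absv (laurent_deriv t b c x) \<le> 1"
  unfolding laurent_deriv_def
proof (intro absv_sum_le)
  fix j assume "j \<in> {1..t}"
  then show "absv (c j * of_int (b j) * x powi (b j - 1)) \<le> 1"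
    using mult_mono[OF bspec[OF c] absv_of_int_le_1[of "b j"]] by (simp add: absv_mult absv_power_int x)
qed simp

section \<open>Hensel's lemma\<close>

text \<open>The ball of radius \<open>d e\<close> around an approximate root \<open>x\<close> of slope \<open>d\<close> consists of units, and
  the simplified Newton map \<open>z \<mapsto> z - F(z) / F'(x)\<close>, whose slope is kept fixed, maps this ball to itself
  and contracts it by the factor \<open>e\<close>.\<close>

lemma laurent_hensel:
  fixes c :: "nat \<Rightarrow> 'a::{ultrametric_abs, complete_space}"
  assumes x: "absv x = 1" and c: "\<forall>j\<in>{1..t}. absv (c j) \<le> 1"
    and e: "0 < e" "e < 1" and d: "absv (laurent_deriv t b c x) = d" "0 < d" "d \<le> 1"
    and val: "absv (laurent_eval t b c x) \<le> d * (d * e)"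
  shows "\<exists>!z. absv (z - x) \<le> d * e \<and> laurent_eval t b c z = 0"
proof -
  let ?F = "laurent_eval t b c" and ?D = "laurent_deriv t b c"
  define N where "N z = z - ?F z / ?D x" for z
  have nz: "?D x \<noteq> 0" using d by auto
  have "d * e \<le> e" using e d by (simp add: mult_left_le_one_le)
  then have "d * e < 1" using e by linarith
  then have r: "0 < d * e" "d * e < 1" using e d by auto
  have unit: "absv z = 1" if "absv (z - x) \<le> d * e" for z
    using absv_eq_of_close[of z x] that r x by simp
  have contr: "absv (N y - N z) \<le> e * absv (y - z)"
    if y: "absv (y - x) \<le> d * e" and z: "absv (z - x) \<le> d * e" for y z
  proof -
    have yz: "absv (y - z) \<le> d * e" using absv_diff_le[OF y z] by simp
    have "N y - N z = ((?D x - ?D z) * (y - z) - (?F y - ?F z - ?D z * (y - z))) / ?D x"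
      using nz by (simp add: N_def field_simps)
    also have "absv \<dots> \<le> (d * e * absv (y - z)) / d"
    proof -
      have "absv ((?D x - ?D z) * (y - z)) \<le> d * e * absv (y - z)"
        unfolding absv_mult
        using laurent_deriv_lipschitz[OF unit[OF z] x c, of b] z
        by (intro mult_right_mono) (auto simp: absv_minus_commute)
      moreover have "absv (?F y - ?F z - ?D z * (y - z)) \<le> d * e * absv (y - z)"
        using laurent_taylor[OF unit[OF z] unit[OF y] c, of b] mult_right_mono[OF yz, of "absv (y - z)"]
        by (simp add: power2_eq_square)
      ultimately have "absv ((?D x - ?D z) * (y - z) - (?F y - ?F z - ?D z * (y - z)))
          \<le> d * e * absv (y - z)"
        by (rule absv_diff_le)
      then show ?thesis
        unfolding absv_divide d(1) using d(2) by (intro divide_right_mono) auto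
    qed
    finally show ?thesis using d by simp
  qed
  have "\<exists>!z\<in>cball x (d * e). N z = z"
  proof (rule Banach_fix[OF complete_eq_closed[THEN iffD2]])
    show "closed (cball x (d * e))" by simp
    show "cball x (d * e) \<noteq> {}" using r by simp
    show "0 \<le> e" "e < 1" using e by auto
    show "dist (N y) (N z) \<le> e * dist y z" if "y \<in> cball x (d * e)" "z \<in> cball x (d * e)" for y z
      using contr[of y z] that by (simp add: dist_absv absv_minus_commute)
    show "N ` cball x (d * e) \<subseteq> cball x (d * e)"
    proof safe
      fix z assume "z \<in> cball x (d * e)"
      then have z: "absv (z - x) \<le> d * e" by (simp add: dist_absv absv_minus_commute)
      have "absv (N z - N x) \<le> d * e"
        using contr[OF z, of x] z e r mult_left_le_one_le[of "absv (z - x)" e] by simp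
      moreover have "absv (N x - x) \<le> d * e"
        using val d by (simp add: N_def absv_divide field_simps)
      ultimately have "absv (N z - x) \<le> d * e"
        using absv_add_le[of "N z - N x" "d * e" "N x - x"] by simp
      then show "N z \<in> cball x (d * e)" by (simp add: dist_absv absv_minus_commute)
    qed
  qed
  moreover have "N z = z \<longleftrightarrow> ?F z = 0" for z using nz by (simp add: N_def)
  ultimately show ?thesis
    by (simp add: dist_absv absv_minus_commute)
qed

text \<open>Zeros of a given slope correspond bijectively to the centres that are approximate roots. This
  turns the number of zeros into a finite sum of indicators of events which only involve the values of
  the polynomial and its derivative at fixed points; both measurability and expectation come from it.\<close>

lemma card_unit_zeros_of_slope:
  fixes c :: "nat \<Rightarrow> 'a::{ultrametric_abs, complete_space}"
  assumes c: "\<forall>j\<in>{1..t}. absv (c j) \<le> 1"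
    and e: "0 < e" "e < 1" and d: "0 < d" "d \<le> 1"
    and S: "\<And>x. x \<in> S \<Longrightarrow> absv x = 1"
      "\<And>z. absv z = 1 \<Longrightarrow> \<exists>!x. x \<in> S \<and> absv (z - x) \<le> d * e"
  shows "card {z. absv z = 1 \<and> laurent_eval t b c z = 0 \<and> absv (laurent_deriv t b c z) = d} =
    card {x \<in> S. absv (laurent_deriv t b c x) = d \<and> absv (laurent_eval t b c x) \<le> d * (d * e)}"
    (is "card ?Z = card ?X")
proof -
  let ?F = "laurent_eval t b c" and ?D = "laurent_deriv t b c"
  have "d * e \<le> e" using e d by (simp add: mult_left_le_one_le)
  then have "d * e < 1" using e by linarith
  then have r: "0 < d * e" "d * e < 1" "d * e < d" using e d by auto
  define z where "z x = (THE z. absv (z - x) \<le> d * e \<and> ?F z = 0)" for x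
  have z: "absv (z x - x) \<le> d * e" "?F (z x) = 0" if "x \<in> ?X" for x
    using theI'[OF laurent_hensel[where b = b and x = x and d = d, OF S(1)[of x] c e]] that d
    unfolding z_def by auto
  have slope: "absv (?D y) = d"
    if "absv (?D x) = d" "absv x = 1" "absv y = 1" "absv (y - x) \<le> d * e" for x y
    using absv_eq_of_close[of "?D y" "?D x"] laurent_deriv_lipschitz[OF that(2,3) c, of b] that r
    by simp
  have "bij_betw z ?X ?Z"
    unfolding bij_betw_def
  proof
    show "inj_on z ?X"
    proof (rule inj_onI)
      fix x y assume xy: "x \<in> ?X" "y \<in> ?X" "z x = z y"
      have "absv (z x) = 1" using absv_eq_of_close[of "z x" x] z(1)[OF xy(1)] S(1)[of x] xy r by simp
      then show "x = y" using S(2)[of "z x"] z(1)[OF xy(1)] z(1)[OF xy(2)] xy by auto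
    qed
    show "z ` ?X = ?Z"
    proof (intro subset_antisym subsetI)
      fix y assume "y \<in> z ` ?X"
      then obtain x where X: "x \<in> ?X" and yx: "y = z x" by blast
      then have x: "x \<in> S" "absv (?D x) = d" "absv (?F x) \<le> d * (d * e)" by auto
      have 1: "absv (z x) = 1"
        using absv_eq_of_close[of "z x" x] z(1)[OF X] S(1)[of x] x r by simp
      have "absv (?D (z x)) = d"
        using slope[of x "z x"] x S(1)[of x] 1 z(1)[OF X] by simp
      then show "y \<in> ?Z" using 1 z(2)[OF X] yx by simp
    next
      fix y assume "y \<in> ?Z"
      then have y: "absv y = 1" "?F y = 0" "d = absv (?D y)" by auto
      then obtain x where x: "x \<in> S" "absv (y - x) \<le> d * e" using S(2) by blast
      then have xy: "absv (x - y) \<le> d * e" by (simp add: absv_minus_commute)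
      have Dx: "absv (?D x) = d" using slope[of y x] y S(1)[OF x(1)] xy by simp
      have "absv (?D y * (x - y)) \<le> d * (d * e)"
        using mult_left_mono[OF xy, of d] d by (simp add: absv_mult y(3))
      moreover have "absv (?F x - ?F y - ?D y * (x - y)) \<le> d * (d * e)"
      proof -
        have "absv (x - y) * absv (x - y) \<le> d * (d * e)"
          using xy r d by (intro mult_mono[OF order_trans[OF xy less_imp_le[OF r(3)]] xy]) simp_all
        then show ?thesis
          using laurent_taylor[OF y(1) S(1)[OF x(1)] c, of b] by (simp add: power2_eq_square)
      qed
      ultimately have "absv (?F x) \<le> d * (d * e)"
        using absv_add_le[of "?F x - ?F y - ?D y * (x - y)" _ "?D y * (x - y)"] y by simp
      then have X: "x \<in> ?X" using x Dx by simp
      then have "z x = y"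
        using laurent_hensel[where b = b and x = x and d = d, OF S(1) c e] z[OF X] x y d by auto
      then show "y \<in> z ` ?X" using X by blast
    qed
  qed
  then show ?thesis by (simp add: bij_betw_same_card)
qed

section \<open>Value group and representatives of balls\<close>

locale uniformized =
  fixes \<pi> :: "'a::nonarch_local_field_0" and \<epsilon> :: real
  assumes uniformizer: "uniformizer \<pi>" and eps_eq: "\<epsilon> = absv \<pi>"
begin

lemma eps_pos: "0 < \<epsilon>" and eps_less_1: "\<epsilon> < 1"
proof -
  have *: "\<pi> \<noteq> 0" "maximal_ideal = (*) \<pi> ` valuation_ring"
    using uniformizer by (auto simp: uniformizer_def)
  have "\<pi> * 1 \<in> maximal_ideal"
    unfolding *(2) by (rule imageI) (simp add: valuation_ring_def)
  then show "0 < \<epsilon>" "\<epsilon> < 1" using * by (simp_all add: maximal_ideal_def eps_eq)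
qed

lemma pi_nonzero: "\<pi> \<noteq> 0"
  using uniformizer by (simp add: uniformizer_def)

lemma absv_pi_powi: "absv (\<pi> powi k) = \<epsilon> powi k"
  by (simp add: absv_power_int eps_eq)

lemma absv_less_1: "absv x < 1 \<Longrightarrow> absv (x::'a) \<le> \<epsilon>"
proof -
  assume "absv x < 1"
  then have "x \<in> maximal_ideal" by (simp add: maximal_ideal_def)
  then have "x \<in> (*) \<pi> ` valuation_ring"
    using uniformizer by (simp add: uniformizer_def)
  then show "absv x \<le> \<epsilon>"
    using eps_pos by (auto simp: absv_mult valuation_ring_def eps_eq mult_left_le)
qed

text \<open>The absolute value of \<open>x\<close> lies in a unique interval \<open>(\<epsilon>\<^bsup>k+1\<^esup>, \<epsilon>\<^sup>k]\<close>. After division by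
  \<open>\<pi>\<^sup>k\<close> it lies in \<open>(\<epsilon>, 1]\<close>, and no absolute value lies strictly between \<open>\<epsilon>\<close> and \<open>1\<close>.\<close>

lemma value_group:
  assumes "x \<noteq> (0::'a)"
  obtains k :: int where "absv x = \<epsilon> powi k"
proof -
  define k where "k = \<lfloor>log \<epsilon> (absv x)\<rfloor>"
  have e: "0 < \<epsilon>" "\<epsilon> < 1" using eps_pos eps_less_1 by auto
  have x: "absv x = \<epsilon> powr (log \<epsilon> (absv x))" using e assms by simp
  have "absv x \<le> \<epsilon> powr k"
    unfolding k_def by (subst x) (use e in \<open>auto intro!: powr_mono'\<close>)
  moreover have "\<epsilon> powr (k + 1) < absv x"
    unfolding k_def by (subst (2) x) (use e in \<open>auto intro!: powr_less_mono'\<close>)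
  ultimately have k: "absv x \<le> \<epsilon> powi k" "\<epsilon> powi (k + 1) < absv x"
    using e by (simp_all flip: powr_real_of_int' add: powr_add) 
  define y where "y = x / \<pi> powi k"
  have "absv y \<le> 1" "\<epsilon> < absv y"
    using k e by (simp_all add: y_def absv_divide absv_pi_powi field_simps power_int_add)
  then have "absv y = 1" using absv_less_1[of y] by linarith
  then have "absv x = \<epsilon> powi k"
    using e by (simp add: y_def absv_divide absv_pi_powi field_simps)
  then show thesis by (rule that)
qed

lemma value_group_nat:
  assumes "x \<noteq> (0::'a)" "absv x \<le> 1"
  obtains m :: nat where "absv x = \<epsilon> ^ m"
proof -
  obtain k where k: "absv x = \<epsilon> powi k" using value_group[OF assms(1)] .
  have "0 \<le> k"
  proof (rule ccontr)
    assume "\<not> 0 \<le> k"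
    then have "\<epsilon> powi 0 < \<epsilon> powi k"
      using eps_pos eps_less_1 by (intro power_int_strict_decreasing) auto
    then show False using k assms(2) by simp
  qed
  then show thesis using that[of "nat k"] k by (simp add: power_int_nonneg_exp)
qed

lemma powi_eps_inj: "\<epsilon> powi k = \<epsilon> powi l \<longleftrightarrow> k = l"
proof -
  have "k < l \<Longrightarrow> \<epsilon> powi l < \<epsilon> powi k" for k l
    using eps_pos eps_less_1 by (intro power_int_strict_decreasing) auto
  from this[of k l] this[of l k] show ?thesis by (cases k l rule: linorder_cases) auto
qed

lemma eps_residue_card: "\<epsilon> = 1 / real (residue_card TYPE('a))"
  using absv_uniformizer[OF uniformizer] by (simp add: eps_eq residue_card_def)

lemma residue_representatives:
  obtains S :: "'a set" where "finite S" "real (card S) = 1 / \<epsilon>"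
    "\<And>s. s \<in> S \<Longrightarrow> absv s \<le> 1" "\<And>x. absv x \<le> 1 \<Longrightarrow> \<exists>!s. s \<in> S \<and> absv (x - s) \<le> \<epsilon>"
proof -
  define R where "R = {(x::'a, y). x \<in> valuation_ring \<and> y \<in> valuation_ring \<and> x - y \<in> maximal_ideal}"
  have R: "(x, y) \<in> R \<longleftrightarrow> absv x \<le> 1 \<and> absv y \<le> 1 \<and> absv (x - y) \<le> \<epsilon>" for x y
    using absv_less_1[of "x - y"] eps_less_1
    by (auto simp: R_def valuation_ring_def maximal_ideal_def)
  have equiv: "equiv valuation_ring R"
  proof (rule equivI)
    show "R \<subseteq> valuation_ring \<times> valuation_ring"
      by (auto simp: R_def)
    show "refl_on valuation_ring R"
      using eps_pos by (auto simp: refl_on_def R) (auto simp: valuation_ring_def)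
    show "sym R" by (auto simp: sym_def R absv_minus_commute)
    show "trans R"
    proof (rule transI)
      fix x y z assume "(x, y) \<in> R" "(y, z) \<in> R"
      then show "(x, z) \<in> R" using absv_add_le[of "x - y" \<epsilon> "y - z"] by (simp add: R)
    qed
  qed
  have Q: "residue_field = valuation_ring // R" by (simp add: residue_field_def R_def)
  define r where "r C = (SOME x. x \<in> C)" for C :: "'a set"
  have r: "r C \<in> C" if "C \<in> valuation_ring // R" for C
    using in_quotient_imp_non_empty[OF equiv that] by (simp add: r_def some_in_eq)
  have inj: "inj_on r (valuation_ring // R)"
  proof (rule inj_onI)
    fix C D assume CD: "C \<in> valuation_ring // R" "D \<in> valuation_ring // R" "r C = r D"
    then show "C = D" using quotient_disj[OF equiv CD(1,2)] r[OF CD(1)] r[OF CD(2)] by auto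
  qed
  show thesis
  proof
    let ?S = "r ` (valuation_ring // R)"
    show "finite ?S" using finite_residue_field[where 'a = 'a] Q by simp
    have "card ?S = residue_card TYPE('a)"
      using card_image[OF inj] Q by (simp add: residue_card_def)
    then show "real (card ?S) = 1 / \<epsilon>" using eps_residue_card by simp
    show "absv s \<le> 1" if "s \<in> ?S" for s
      using that r in_quotient_imp_subset[OF equiv] by (fastforce simp: valuation_ring_def)
    show "\<exists>!s. s \<in> ?S \<and> absv (x - s) \<le> \<epsilon>" if "absv x \<le> 1" for x
    proof -
      have x: "x \<in> valuation_ring" using that by (simp add: valuation_ring_def)
      have C: "R `` {x} \<in> valuation_ring // R" using x by (rule quotientI)
      show ?thesis
      proof (rule ex1I[of _ "r (R `` {x})"])
        show "r (R `` {x}) \<in> ?S \<and> absv (x - r (R `` {x})) \<le> \<epsilon>"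
          using r[OF C] C by (auto simp: R)
        fix s assume s: "s \<in> ?S \<and> absv (x - s) \<le> \<epsilon>"
        then obtain D where D: "D \<in> valuation_ring // R" "s = r D" by auto
        have "s \<in> valuation_ring" using D r in_quotient_imp_subset[OF equiv D(1)] by auto
        then have "(x, s) \<in> R" using s that by (simp add: R valuation_ring_def)
        then have "D = R `` {x}"
          using quotient_disj[OF equiv D(1) C] r[OF D(1)] D(2) by auto
        then show "s = r (R `` {x})" using D by simp
      qed
    qed
  qed
qed

text \<open>Induction on \<open>n\<close> by \<open>\<pi>\<close>-adic expansion: an integral element is given modulo \<open>\<pi>\<^bsup>n+1\<^esup>\<close> by a
  representative \<open>s\<close> modulo \<open>\<pi>\<^sup>n\<close> and one further digit \<open>u\<close>, as \<open>s + \<pi>\<^sup>n u\<close>.\<close>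

lemma ball_representatives:
  obtains S :: "'a set" where "finite S" "real (card S) = 1 / \<epsilon> ^ n"
    "\<And>s. s \<in> S \<Longrightarrow> absv s \<le> 1" "\<And>x. absv x \<le> 1 \<Longrightarrow> \<exists>!s. s \<in> S \<and> absv (x - s) \<le> \<epsilon> ^ n"
proof (induction n arbitrary: thesis)
  case 0
  show ?case
  proof (rule 0)
    show "finite {0::'a}" by simp
  qed auto
next
  case (Suc n)
  obtain S :: "'a set" where S: "finite S" "real (card S) = 1 / \<epsilon> ^ n"
    "\<And>s. s \<in> S \<Longrightarrow> absv s \<le> 1" "\<And>x. absv x \<le> 1 \<Longrightarrow> \<exists>!s. s \<in> S \<and> absv (x - s) \<le> \<epsilon> ^ n"
    using Suc.IH by blast
  obtain T :: "'a set" where T: "finite T" "real (card T) = 1 / \<epsilon>"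
    "\<And>s. s \<in> T \<Longrightarrow> absv s \<le> 1" "\<And>x. absv x \<le> 1 \<Longrightarrow> \<exists>!s. s \<in> T \<and> absv (x - s) \<le> \<epsilon>"
    using residue_representatives by blast
  have e: "0 < \<epsilon>" "\<epsilon> < 1" "\<epsilon> ^ n \<le> 1" using eps_pos eps_less_1 by (auto simp: power_le_one)
  let ?f = "\<lambda>(s, u). s + \<pi> ^ n * u"
  have pin: "absv (\<pi> ^ n * u) = \<epsilon> ^ n * absv u" for u by (simp add: absv_mult absv_power eps_eq)
  \<comment> \<open>The residue modulo \<open>\<pi>\<^sup>n\<close> determines \<open>s\<close>; then \<open>u\<close> is the residue of \<open>(x - s) / \<pi>\<^sup>n\<close>.\<close>
  have uniq: "s = s' \<and> u = u'"
    if su: "s \<in> S" "u \<in> T" "s' \<in> S" "u' \<in> T" and x: "absv x \<le> 1"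
      and c: "absv (x - ?f (s, u)) \<le> \<epsilon> ^ Suc n" "absv (x - ?f (s', u')) \<le> \<epsilon> ^ Suc n" for s u s' u' x
  proof -
    have le: "\<epsilon> ^ Suc n \<le> \<epsilon> ^ n" using e by (simp add: mult_left_le_one_le)
    have near: "absv (x - s) \<le> \<epsilon> ^ n" if "u \<in> T" "absv (x - ?f (s, u)) \<le> \<epsilon> ^ Suc n" for s u
    proof -
      have "absv (\<pi> ^ n * u) \<le> \<epsilon> ^ n" using T(3)[OF that(1)] e by (simp add: pin mult_left_le)
      then show ?thesis
        using absv_add_le[of "x - ?f (s, u)" "\<epsilon> ^ n" "\<pi> ^ n * u"] that(2) le
        by (simp add: algebra_simps)
    qed
    have s: "s = s'" using S(4)[OF x] near[of u s] near[of u' s'] su c by auto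
    define v where "v = (x - s) / \<pi> ^ n"
    have v: "x = s + \<pi> ^ n * v" using pi_nonzero by (simp add: v_def)
    have "absv v \<le> 1"
      using near[OF su(2) c(1)] e by (simp add: v_def absv_divide absv_power flip: eps_eq)
    moreover have "absv (v - u) \<le> \<epsilon>" if "absv (x - ?f (s, u)) \<le> \<epsilon> ^ Suc n" for u
    proof -
      have "x - ?f (s, u) = \<pi> ^ n * (v - u)" by (subst v) (simp add: algebra_simps)
      then show ?thesis using that e by (simp add: pin)
    qed
    ultimately have "u = u'" using T(4)[of v] su c s by auto
    with s show ?thesis by simp
  qed
  have f1: "absv (?f (s, u)) \<le> 1" if "s \<in> S" "u \<in> T" for s u
    using S(3)[OF that(1)] T(3)[OF that(2)] e
    by (auto intro!: absv_add_le mult_le_one simp: pin)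
  have inj: "inj_on ?f (S \<times> T)"
  proof (rule inj_onI, clarify)
    fix s u s' u' assume "s \<in> S" "u \<in> T" "s' \<in> S" "u' \<in> T" "s + \<pi> ^ n * u = s' + \<pi> ^ n * u'"
    then show "s = s' \<and> u = u'"
      using uniq[of s u s' u' "?f (s, u)"] f1[of s u] e by simp
  qed
  show ?case
  proof (rule Suc.prems)
    show "finite (?f ` (S \<times> T))" using S T by simp
    show "real (card (?f ` (S \<times> T))) = 1 / \<epsilon> ^ Suc n"
      using S T by (simp add: card_image[OF inj] card_cartesian_product)
    show "absv s \<le> 1" if "s \<in> ?f ` (S \<times> T)" for s using that f1 by auto
    show "\<exists>!s. s \<in> ?f ` (S \<times> T) \<and> absv (x - s) \<le> \<epsilon> ^ Suc n" if x: "absv x \<le> 1" for x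
    proof -
      obtain s where s: "s \<in> S" "absv (x - s) \<le> \<epsilon> ^ n" using S(4)[OF x] by blast
      define v where "v = (x - s) / \<pi> ^ n"
      have v: "x = s + \<pi> ^ n * v" using pi_nonzero by (simp add: v_def)
      have "absv v \<le> 1" using s e by (simp add: v_def absv_divide absv_power flip: eps_eq)
      then obtain u where u: "u \<in> T" "absv (v - u) \<le> \<epsilon>" using T(4) by blast
      have "x - ?f (s, u) = \<pi> ^ n * (v - u)" by (subst v) (simp add: algebra_simps)
      then have "absv (x - ?f (s, u)) \<le> \<epsilon> ^ Suc n" using u e by (simp add: pin)
      then show ?thesis using s u uniq x by blast
    qed
  qed
qed

end

section \<open>Measurability of linear combinations\<close>

lemma ex_uniformized: "\<exists>\<pi> :: 'a::nonarch_local_field_0. uniformized \<pi> (absv \<pi>)"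
  using ex_uniformizer by (auto simp: uniformized_def)

text \<open>Sums of Borel functions are Borel if addition is continuous and the topology has a countable
  basis: then the Borel sets of the product are generated by rectangles.\<close>

instance nonarch_local_field_0 \<subseteq> topological_comm_monoid_add
proof
  fix a b :: 'a
  show "LIM x (nhds a \<times>\<^sub>F nhds b). fst x + snd x :> nhds (a + b)"
    unfolding tendsto_iff
  proof (intro allI impI)
    fix e :: real assume e: "0 < e"
    have "\<forall>\<^sub>F x in nhds a \<times>\<^sub>F nhds b. dist (fst x) a < e \<and> dist (snd x) b < e"
      using tendstoD[OF filterlim_fst e] tendstoD[OF filterlim_snd e] by (rule eventually_conj)
    then show "\<forall>\<^sub>F x in nhds a \<times>\<^sub>F nhds b. dist (fst x + snd x) (a + b) < e"
    proof eventually_elim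
      case (elim x)
      have *: "fst x + snd x - (a + b) = (fst x - a) + (snd x - b)" by simp
      then show ?case
        using absv_ultrametric[of "fst x - a" "snd x - b"] elim
        unfolding dist_absv * by linarith
    qed
  qed
qed

text \<open>The quotients \<open>s / \<pi>\<^sup>k\<close>, with \<open>s\<close> from the finite sets of ball representatives, form a countable
  dense set.\<close>

instance nonarch_local_field_0 \<subseteq> second_countable_topology
proof
  obtain \<pi> :: 'a where "uniformized \<pi> (absv \<pi>)" using ex_uniformized by blast
  then interpret uniformized \<pi> "absv \<pi>" .
  let ?e = "absv \<pi>"
  define S where "S n = (SOME S :: 'a set. finite S \<and>
    (\<forall>x. absv x \<le> 1 \<longrightarrow> (\<exists>s\<in>S. absv (x - s) \<le> ?e ^ n)))" for n
  have S: "finite (S n)" "\<And>x. absv x \<le> 1 \<Longrightarrow> \<exists>s\<in>S n. absv (x - s) \<le> ?e ^ n" for n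
  proof -
    have "\<exists>S. finite S \<and> (\<forall>x::'a. absv x \<le> 1 \<longrightarrow> (\<exists>s\<in>S. absv (x - s) \<le> ?e ^ n))"
    proof -
      obtain S :: "'a set" where "finite S"
        "\<And>x. absv x \<le> 1 \<Longrightarrow> \<exists>!s. s \<in> S \<and> absv (x - s) \<le> ?e ^ n"
        using ball_representatives[of n] by metis
      then show ?thesis by (intro exI[of _ S]) blast
    qed
    from someI_ex[OF this, folded S_def]
    show "finite (S n)" "\<And>x. absv x \<le> 1 \<Longrightarrow> \<exists>s\<in>S n. absv (x - s) \<le> ?e ^ n" by auto
  qed
  define D where "D = (\<Union>k::nat. \<Union>n. (\<lambda>s. s / \<pi> ^ k) ` S n)"
  have "countable D" unfolding D_def using S(1) by (intro countable_UN) (auto intro: countable_finite)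
  define B where "B = (\<lambda>(x, n::nat). ball x (inverse (real (Suc n)))) ` (D \<times> UNIV)"
  have "countable B" unfolding B_def using \<open>countable D\<close> by simp
  have dense: "\<exists>d\<in>D. absv (x - d) < r" if "0 < r" for x :: 'a and r :: real
  proof -
    obtain k where k: "absv x * ?e ^ k \<le> 1"
    proof (cases "x = 0")
      case False
      obtain k where "?e ^ k < inverse (absv x)"
        using real_arch_pow_inv[of "inverse (absv x)" ?e] False eps_less_1 by auto
      then have "absv x * ?e ^ k \<le> 1" using False by (simp add: field_simps)
      then show ?thesis by (rule that)
    qed (use that[of 0] in simp)
    obtain n where n: "?e ^ n < r * ?e ^ k"
      using real_arch_pow_inv[of "r * ?e ^ k" ?e] \<open>0 < r\<close> eps_less_1 pi_nonzero by auto
    obtain s where s: "s \<in> S n" "absv (x * \<pi> ^ k - s) \<le> ?e ^ n"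
      using S(2)[of "x * \<pi> ^ k" n] k by (auto simp: absv_mult absv_power)
    have "x - s / \<pi> ^ k = (x * \<pi> ^ k - s) / \<pi> ^ k" using pi_nonzero by (simp add: field_simps)
    then have "absv (x - s / \<pi> ^ k) < r"
      using s n pi_nonzero by (simp add: absv_divide absv_power field_simps)
    then show ?thesis using s(1) by (auto simp: D_def)
  qed
  have "topological_basis B"
  proof (rule topological_basisI)
    fix U and x :: 'a assume "open U" "x \<in> U"
    then obtain r where r: "0 < r" "ball x r \<subseteq> U" by (auto simp: open_contains_ball)
    obtain n where n: "inverse (real (Suc n)) < r / 2" using reals_Archimedean[of "r / 2"] r by auto
    obtain d where d: "d \<in> D" "absv (x - d) < inverse (real (Suc n))"
      using dense[of "inverse (real (Suc n))" x] by auto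
    have dx: "dist d x < inverse (real (Suc n))" using d by (simp add: dist_absv absv_minus_commute)
    have "ball d (inverse (real (Suc n))) \<subseteq> ball x r"
    proof
      fix y assume "y \<in> ball d (inverse (real (Suc n)))"
      then have "dist x y < r" using dx n dist_triangle3[of x y d] by (simp del: of_nat_Suc)
      then show "y \<in> ball x r" by simp
    qed
    then have "x \<in> ball d (inverse (real (Suc n)))" "ball d (inverse (real (Suc n))) \<subseteq> U"
      using dx r by (simp del: of_nat_Suc, blast)
    then show "\<exists>C\<in>B. x \<in> C \<and> C \<subseteq> U" unfolding B_def using d(1) by auto
  qed (auto simp: B_def)
  then show "\<exists>B::'a set set. countable B \<and> open = generate_topology B"
    using \<open>countable B\<close> topological_basis_imp_subbasis by blast
qed

lemma borel_measurable_mult_const: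
  fixes f :: "'b \<Rightarrow> 'a::nonarch_local_field_0"
  assumes "f \<in> borel_measurable N"
  shows "(\<lambda>x. f x * v) \<in> borel_measurable N"
proof -
  have "continuous_on UNIV (\<lambda>x::'a. x * v)"
  proof (rule continuous_onI)
    fix x :: 'a and e :: real assume "0 < e"
    have "dist (x' * v) (x * v) \<le> e" if "dist x' x < e / (absv v + 1)" for x'
    proof -
      have "dist (x' * v) (x * v) = dist x' x * absv v"
        by (simp add: dist_absv absv_mult flip: left_diff_distrib)
      also have "\<dots> \<le> e / (absv v + 1) * (absv v + 1)"
        using that \<open>0 < e\<close> by (intro mult_mono) auto
      also have "\<dots> = e" using add_nonneg_pos[OF absv_nonneg[of v] zero_less_one] by simp
      finally show ?thesis .
    qed
    moreover have "0 < e / (absv v + 1)" using \<open>0 < e\<close> absv_nonneg[of v] by (simp add: add_nonneg_pos)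
    ultimately show "\<exists>d>0. \<forall>x'\<in>UNIV. dist x' x < d \<longrightarrow> dist (x' * v) (x * v) \<le> e" by blast
  qed
  then show ?thesis
    using measurable_compose[OF assms borel_measurable_continuous_onI] by simp
qed

lemma borel_measurable_absv_diff:
  fixes f :: "'b \<Rightarrow> 'a::nonarch_local_field_0"
  shows "f \<in> borel_measurable N \<Longrightarrow> (\<lambda>x. absv (f x - r)) \<in> borel_measurable N"
  unfolding dist_absv[symmetric] by (intro borel_measurable_dist) auto

section \<open>The Haar measure of balls\<close>

locale uniformized_Haar = uniformized \<pi> \<epsilon>
  for \<pi> :: "'a::nonarch_local_field_0" and \<epsilon> +
  fixes \<mu> :: "'a measure"
  assumes Haar: "normalized_Haar_measure \<mu>"
begin

sublocale \<mu>: prob_space \<mu>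
  using Haar by (simp add: normalized_Haar_measure_def)

lemma space_Haar: "space \<mu> = {x. absv x \<le> 1}"
  using Haar by (simp add: normalized_Haar_measure_def valuation_ring_def)

lemma sets_Haar: "sets \<mu> = sets (restrict_space borel {x. absv x \<le> 1})"
  using Haar by (simp add: normalized_Haar_measure_def valuation_ring_def)

lemma cball_conv: "{x. absv (x - r) \<le> e} = cball (r::'a) e"
  by (auto simp: dist_absv absv_minus_commute)

lemma ball_in_sets_Haar:
  assumes "absv r \<le> 1" "e \<le> 1"
  shows "{x. absv (x - r) \<le> e} \<in> sets \<mu>"
proof -
  have "absv x \<le> 1" if "absv (x - r) \<le> e" for x
    using absv_add_le[of "x - r" 1 r] that assms by simp
  then have "{x. absv (x - r) \<le> e} = cball r e \<inter> {x. absv x \<le> 1}"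
    by (auto simp: cball_conv[symmetric])
  then show ?thesis unfolding sets_Haar sets_restrict_space by (auto intro!: image_eqI)
qed

lemma measurable_Haar_iff:
  "f \<in> measurable M \<mu> \<longleftrightarrow> f \<in> borel_measurable M \<and> (\<forall>\<omega>\<in>space M. absv (f \<omega>) \<le> 1)"
proof -
  have "f \<in> measurable M \<mu> \<longleftrightarrow> f \<in> measurable M (restrict_space borel {x. absv x \<le> 1})"
    by (rule arg_cong[where f = "\<lambda>A. f \<in> A"]) (rule measurable_cong_sets[OF refl sets_Haar])
  then show ?thesis by (auto simp: measurable_restrict_space2_iff)
qed

lemma eps_power_le_1: "\<epsilon> ^ n \<le> 1"
  using eps_pos eps_less_1 by (simp add: power_le_one)

lemma measure_ball_translate:
  assumes "absv r \<le> 1"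
  shows "measure \<mu> {x. absv (x - r) \<le> \<epsilon> ^ n} = measure \<mu> {x. absv x \<le> \<epsilon> ^ n}"
proof -
  have id: "(\<lambda>x. x) \<in> borel_measurable \<mu>" "\<forall>x\<in>space \<mu>. absv x \<le> 1"
    using measurable_Haar_iff[of "\<lambda>x. x" \<mu>] by simp_all
  have m: "(\<lambda>x. r + x) \<in> measurable \<mu> \<mu>"
    unfolding measurable_Haar_iff using assms id by (auto intro!: absv_add_le borel_measurable_add)
  have "measure \<mu> {x. absv (x - r) \<le> \<epsilon> ^ n} =
    measure (distr \<mu> \<mu> (\<lambda>x. r + x)) {x. absv (x - r) \<le> \<epsilon> ^ n}"
    using Haar assms by (simp add: normalized_Haar_measure_def valuation_ring_def)
  also have "\<dots> = measure \<mu> ((\<lambda>x. r + x) -` {x. absv (x - r) \<le> \<epsilon> ^ n} \<inter> space \<mu>)"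
    by (rule measure_distr[OF m ball_in_sets_Haar[OF assms eps_power_le_1]])
  also have "(\<lambda>x. r + x) -` {x. absv (x - r) \<le> \<epsilon> ^ n} \<inter> space \<mu> = {x. absv x \<le> \<epsilon> ^ n}"
    using eps_power_le_1[of n] by (auto simp: space_Haar)
  finally show ?thesis .
qed

text \<open>The balls of radius \<open>\<epsilon>\<^sup>n\<close> around representatives partition the valuation ring into \<open>\<epsilon>\<^bsup>-n\<^esup>\<close>
  translates of each other.\<close>

lemma measure_ball:
  assumes "absv r \<le> 1"
  shows "measure \<mu> {x. absv (x - r) \<le> \<epsilon> ^ n} = \<epsilon> ^ n"
proof -
  obtain S :: "'a set" where S: "finite S" "real (card S) = 1 / \<epsilon> ^ n"
    "\<And>s. s \<in> S \<Longrightarrow> absv s \<le> 1" "\<And>x. absv x \<le> 1 \<Longrightarrow> \<exists>!s. s \<in> S \<and> absv (x - s) \<le> \<epsilon> ^ n"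
    using ball_representatives by blast
  let ?B = "\<lambda>s. {x. absv (x - s) \<le> \<epsilon> ^ n}"
  have in1: "absv x \<le> 1" if "s \<in> S" "absv (x - s) \<le> \<epsilon> ^ n" for x s
    using absv_add_le[of "x - s" 1 s] that S(3) eps_power_le_1[of n] by simp
  have "1 = measure \<mu> (\<Union>s\<in>S. ?B s)"
  proof -
    have "(\<Union>s\<in>S. ?B s) = space \<mu>" using in1 S(4) by (auto simp: space_Haar) blast
    then show ?thesis by (simp add: \<mu>.prob_space)
  qed
  also have "\<dots> = (\<Sum>s\<in>S. measure \<mu> (?B s))"
  proof (rule \<mu>.finite_measure_finite_Union)
    show "?B ` S \<subseteq> sets \<mu>" using S(3) eps_power_le_1 by (auto intro: ball_in_sets_Haar)
    show "disjoint_family_on ?B S"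
      unfolding disjoint_family_on_def using S(4) in1 by (fastforce simp: set_eq_iff)
  qed fact
  also have "\<dots> = (\<Sum>s\<in>S. measure \<mu> (?B r))"
    using S(3) assms by (intro sum.cong refl) (simp add: measure_ball_translate)
  also have "\<dots> = measure \<mu> (?B r) / \<epsilon> ^ n" by (simp add: S(2))
  finally show ?thesis using eps_pos by (simp add: field_simps)
qed

text \<open>A ball of radius less than one around an integral element consists of units or contains none.
  The balls of the first kind fill up the units, a set of measure \<open>1 - \<epsilon>\<close>, which gives their number.\<close>

lemma unit_representatives:
  obtains S :: "'a set" where "finite S" "real (card S) = (1 - \<epsilon>) / \<epsilon> ^ Suc m"
    "\<And>s. s \<in> S \<Longrightarrow> absv s = 1"
    "\<And>z. absv z = 1 \<Longrightarrow> \<exists>!s. s \<in> S \<and> absv (z - s) \<le> \<epsilon> ^ Suc m"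
proof -
  obtain S :: "'a set" where S1: "finite S" and "real (card S) = 1 / \<epsilon> ^ Suc m"
    and S: "\<And>s. s \<in> S \<Longrightarrow> absv s \<le> 1"
      "\<And>x. absv x \<le> 1 \<Longrightarrow> \<exists>!s. s \<in> S \<and> absv (x - s) \<le> \<epsilon> ^ Suc m"
    using ball_representatives by blast
  define T where "T = {s \<in> S. absv s = 1}"
  let ?B = "\<lambda>s. {x. absv (x - s) \<le> \<epsilon> ^ Suc m}"
  have lt1: "\<epsilon> ^ Suc m < 1" using eps_pos eps_less_1 by (rule power_Suc_less_one)
  have same: "absv x = 1 \<longleftrightarrow> absv s = 1" if "absv (x - s) \<le> \<epsilon> ^ Suc m" for x s
    using absv_eq_of_close[of x s] absv_eq_of_close[of s x] that lt1
    by (auto simp: absv_minus_commute)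
  have T: "\<exists>!s. s \<in> T \<and> absv (z - s) \<le> \<epsilon> ^ Suc m" if "absv z = 1" for z
    using S(2)[of z] same[of z] that by (auto simp: T_def)
  have "1 - \<epsilon> = measure \<mu> (space \<mu> - {x. absv (x - 0) \<le> \<epsilon> ^ 1})"
    using measure_ball[of 0 1] ball_in_sets_Haar[of 0 "\<epsilon> ^ 1"] eps_less_1
    by (simp add: \<mu>.prob_compl)
  also have "space \<mu> - {x. absv (x - 0) \<le> \<epsilon> ^ 1} = (\<Union>s\<in>T. ?B s)"
  proof -
    have "space \<mu> - {x. absv (x - 0) \<le> \<epsilon> ^ 1} = {x. absv x = 1}"
      using absv_less_1 eps_less_1 by (force simp: space_Haar)
    also have "\<dots> = (\<Union>s\<in>T. ?B s)"
    proof (intro set_eqI iffI)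
      fix x assume "x \<in> (\<Union>s\<in>T. ?B s)"
      then obtain s where "s \<in> T" "absv (x - s) \<le> \<epsilon> ^ Suc m" by blast
      then show "x \<in> {x. absv x = 1}" using same[of x s] by (simp add: T_def)
    qed (use T in blast)
    finally show ?thesis .
  qed
  also have "measure \<mu> \<dots> = (\<Sum>s\<in>T. measure \<mu> (?B s))"
  proof (rule \<mu>.finite_measure_finite_Union)
    show "finite T" using S1 by (simp add: T_def)
    show "?B ` T \<subseteq> sets \<mu>" using lt1 by (auto simp: T_def intro!: ball_in_sets_Haar)
    show "disjoint_family_on ?B T"
      unfolding disjoint_family_on_def
    proof safe
      fix s s' x assume "s \<in> T" "s' \<in> T" "s \<noteq> s'" "absv (x - s) \<le> \<epsilon> ^ Suc m" "absv (x - s') \<le> \<epsilon> ^ Suc m"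
      moreover have "absv x = 1" using same[of x s] calculation by (simp add: T_def)
      ultimately show "x \<in> {}" using T[of x] by blast
    qed
  qed
  also have "\<dots> = (\<Sum>s\<in>T. \<epsilon> ^ Suc m)"
    by (intro sum.cong refl measure_ball) (simp add: T_def)
  also have "\<dots> = real (card T) * \<epsilon> ^ Suc m" by simp
  finally have "real (card T) = (1 - \<epsilon>) / \<epsilon> ^ Suc m" using eps_pos by (simp add: field_simps)
  moreover have "finite T" "\<And>s. s \<in> T \<Longrightarrow> absv s = 1" using S1 by (simp_all add: T_def)
  ultimately show thesis using T by (intro that[of T])
qed

end

section \<open>Linear forms in independent uniform coefficients\<close>

locale uniform_coefficients = uniformized_Haar \<pi> \<epsilon> \<mu> + M: prob_space M
  for \<pi> :: "'a::nonarch_local_field_0" and \<epsilon> \<mu> and M :: "'w measure" +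
  fixes c :: "nat \<Rightarrow> 'w \<Rightarrow> 'a" and t :: nat
  assumes iid: "iid_uniform M {1..t} c \<mu>"
begin

lemma coefficient_measurable:
  assumes "j \<in> {1..t}"
  shows "c j \<in> measurable M \<mu>" "c j \<in> borel_measurable M"
    "\<And>\<omega>. \<omega> \<in> space M \<Longrightarrow> absv (c j \<omega>) \<le> 1"
proof -
  show 1: "c j \<in> measurable M \<mu>"
    using iid assms by (auto simp: iid_uniform_def M.indep_vars_def)
  show "c j \<in> borel_measurable M" "\<And>\<omega>. \<omega> \<in> space M \<Longrightarrow> absv (c j \<omega>) \<le> 1"
    using 1 unfolding measurable_Haar_iff by auto
qed

lemma prob_coefficient_ball:
  assumes "j \<in> {1..t}" "absv r \<le> 1"
  shows "M.prob {\<omega> \<in> space M. absv (c j \<omega> - r) \<le> \<epsilon> ^ n} = \<epsilon> ^ n"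
proof -
  have "\<epsilon> ^ n = measure (distr M \<mu> (c j)) {x. absv (x - r) \<le> \<epsilon> ^ n}"
    using iid assms by (simp add: iid_uniform_def measure_ball)
  also have "\<dots> = M.prob (c j -` {x. absv (x - r) \<le> \<epsilon> ^ n} \<inter> space M)"
    using assms eps_power_le_1
    by (intro measure_distr coefficient_measurable ball_in_sets_Haar)
  also have "c j -` {x. absv (x - r) \<le> \<epsilon> ^ n} \<inter> space M = {\<omega> \<in> space M. absv (c j \<omega> - r) \<le> \<epsilon> ^ n}"
    by auto
  finally show ?thesis by simp
qed

lemma linear_form_measurable:
  assumes "J \<subseteq> {1..t}"
  shows "(\<lambda>y. \<Sum>j\<in>J. y j * v j) \<in> borel_measurable (Pi\<^sub>M J (\<lambda>_. \<mu>))"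
proof (intro borel_measurable_sum borel_measurable_mult_const)
  fix j assume "j \<in> J"
  then show "(\<lambda>y. y j) \<in> borel_measurable (Pi\<^sub>M J (\<lambda>_. \<mu>))"
    using measurable_component_singleton[of j J "\<lambda>_. \<mu>"] unfolding measurable_Haar_iff by simp
qed

text \<open>Adding to the uniform coefficient \<open>c\<^sub>i\<close> an integral quantity that depends only on the other
  coefficients leaves it uniform and independent of them. Splitting by the residue \<open>s\<close> of that quantity
  modulo \<open>\<pi>\<^sup>n\<close> replaces it by a constant, where independence and the law of \<open>c\<^sub>i\<close> apply.\<close>

lemma prob_pivot:
  assumes i: "i \<in> {1..t}" and J: "J = {1..t} - {i}"
    and v: "\<And>j. j \<in> J \<Longrightarrow> absv (v j) \<le> 1"
    and Q: "Q \<in> sets (Pi\<^sub>M J (\<lambda>_. \<mu>))"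
  shows "M.prob {\<omega> \<in> space M. restrict (\<lambda>j. c j \<omega>) J \<in> Q \<and>
      absv (c i \<omega> + (\<Sum>j\<in>J. c j \<omega> * v j)) \<le> \<epsilon> ^ n} =
    \<epsilon> ^ n * M.prob {\<omega> \<in> space M. restrict (\<lambda>j. c j \<omega>) J \<in> Q}"
proof -
  define Y where "Y \<omega> = restrict (\<lambda>j. c j \<omega>) J" for \<omega>
  define \<sigma> where "\<sigma> y = (\<Sum>j\<in>J. y j * v j)" for y
  have \<sigma>Y: "\<sigma> (Y \<omega>) = (\<Sum>j\<in>J. c j \<omega> * v j)" for \<omega>
    unfolding \<sigma>_def Y_def by (intro sum.cong) auto
  have \<sigma>_le: "absv (\<sigma> (Y \<omega>)) \<le> 1" if "\<omega> \<in> space M" for \<omega>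
    unfolding \<sigma>Y using coefficient_measurable(3) v that J
    by (intro absv_sum_le) (auto simp: absv_mult intro!: mult_le_one)
  have \<sigma>_meas: "\<sigma> \<in> borel_measurable (Pi\<^sub>M J (\<lambda>_. \<mu>))"
    unfolding \<sigma>_def by (rule linear_form_measurable) (auto simp: J)
  have indep: "M.indep_var (Pi\<^sub>M {i} (\<lambda>_. \<mu>)) (\<lambda>\<omega>. restrict (\<lambda>j. c j \<omega>) {i})
      (Pi\<^sub>M J (\<lambda>_. \<mu>)) Y"
    using iid i unfolding iid_uniform_def Y_def[abs_def]
    by (intro M.indep_var_restrict) (auto simp: J)
  have Y_meas: "Y \<in> measurable M (Pi\<^sub>M J (\<lambda>_. \<mu>))"
    unfolding Y_def by (intro measurable_restrict coefficient_measurable) (auto simp: J)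
  obtain S :: "'a set" where S1: "finite S" and "real (card S) = 1 / \<epsilon> ^ n" and S:
    "\<And>s. s \<in> S \<Longrightarrow> absv s \<le> 1" "\<And>x. absv x \<le> 1 \<Longrightarrow> \<exists>!s. s \<in> S \<and> absv (x - s) \<le> \<epsilon> ^ n"
    using ball_representatives by blast
  define B where "B s = Q \<inter> {y \<in> space (Pi\<^sub>M J (\<lambda>_. \<mu>)). absv (\<sigma> y - s) \<le> \<epsilon> ^ n}" for s
  have B: "B s \<in> sets (Pi\<^sub>M J (\<lambda>_. \<mu>))" for s
    unfolding B_def
    by (intro sets.Int Q borel_measurable_le borel_measurable_absv_diff \<sigma>_meas) auto
  define E where "E s = {\<omega> \<in> space M. c i \<omega> \<in> {x. absv (x - (- s)) \<le> \<epsilon> ^ n} \<and> Y \<omega> \<in> B s}" for s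
  define F where "F s = {\<omega> \<in> space M. Y \<omega> \<in> B s}" for s
  have BY: "Y \<omega> \<in> B s \<longleftrightarrow> Y \<omega> \<in> Q \<and> absv (\<sigma> (Y \<omega>) - s) \<le> \<epsilon> ^ n" if "\<omega> \<in> space M" for \<omega> s
    using measurable_space[OF Y_meas that] by (auto simp: B_def)
  have F_sets: "F s \<in> sets M" for s
    using measurable_sets[OF Y_meas B] by (simp add: F_def vimage_def Int_def conj_commute)
  have ci_sets: "{\<omega> \<in> space M. c i \<omega> \<in> {x. absv (x - (- s)) \<le> \<epsilon> ^ n}} \<in> sets M" if "s \<in> S" for s
    using measurable_sets[OF coefficient_measurable(1)[OF i] ball_in_sets_Haar[of "- s" "\<epsilon> ^ n"]]
      S(1)[OF that] eps_power_le_1[of n]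
    by (simp add: vimage_def Int_def conj_commute)
  have E_sets: "E s \<in> sets M" if "s \<in> S" for s
  proof -
    have "E s = {\<omega> \<in> space M. c i \<omega> \<in> {x. absv (x - (- s)) \<le> \<epsilon> ^ n}} \<inter> F s"
      by (auto simp: E_def F_def)
    then show ?thesis using ci_sets[OF that] F_sets[of s] by auto
  qed
  have prob_E: "M.prob (E s) = \<epsilon> ^ n * M.prob (F s)" if "s \<in> S" for s
  proof -
    define C where "C = (\<lambda>f. f i) -` {x. absv (x - (- s)) \<le> \<epsilon> ^ n} \<inter> space (Pi\<^sub>M {i} (\<lambda>_. \<mu>))"
    let ?X = "\<lambda>\<omega>. restrict (\<lambda>j. c j \<omega>) {i}"
    have C: "C \<in> sets (Pi\<^sub>M {i} (\<lambda>_. \<mu>))"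
      using S(1)[OF that] eps_power_le_1 unfolding C_def
      by (intro measurable_sets[OF measurable_component_singleton] ball_in_sets_Haar) auto
    have X: "?X \<omega> \<in> C \<longleftrightarrow> c i \<omega> \<in> {x. absv (x - (- s)) \<le> \<epsilon> ^ n}" if "\<omega> \<in> space M" for \<omega>
      using coefficient_measurable(3)[OF i that] by (simp add: C_def space_PiM space_Haar)
    have "M.prob ((\<lambda>\<omega>. (?X \<omega>, Y \<omega>)) -` (C \<times> B s) \<inter> space M) =
      M.prob (?X -` C \<inter> space M) * M.prob (Y -` B s \<inter> space M)"
      by (rule M.indep_varD[OF indep C B])
    moreover have "(\<lambda>\<omega>. (?X \<omega>, Y \<omega>)) -` (C \<times> B s) \<inter> space M = E s" "Y -` B s \<inter> space M = F s"
      "?X -` C \<inter> space M = {\<omega> \<in> space M. absv (c i \<omega> - (- s)) \<le> \<epsilon> ^ n}"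
      using X by (auto simp: E_def F_def)
    ultimately show ?thesis
      using prob_coefficient_ball[OF i, of "- s" n] S(1)[OF that] by simp
  qed
  have disj_F: "disjoint_family_on F S"
    unfolding disjoint_family_on_def
  proof safe
    fix s s' \<omega> assume *: "s \<in> S" "s' \<in> S" "s \<noteq> s'" "\<omega> \<in> F s" "\<omega> \<in> F s'"
    then have "\<omega> \<in> space M" by (simp add: F_def)
    then show "\<omega> \<in> {}" using S(2)[OF \<sigma>_le[of \<omega>]] * BY by (auto simp: F_def)
  qed
  have UF: "{\<omega> \<in> space M. Y \<omega> \<in> Q} = (\<Union>s\<in>S. F s)"
    using S(2)[OF \<sigma>_le] BY by (auto simp: F_def) (metis)
  have UE: "{\<omega> \<in> space M. Y \<omega> \<in> Q \<and> absv (c i \<omega> + \<sigma> (Y \<omega>)) \<le> \<epsilon> ^ n} = (\<Union>s\<in>S. E s)"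
  proof -
    have iff: "absv (c i \<omega> + \<sigma> (Y \<omega>)) \<le> \<epsilon> ^ n \<longleftrightarrow> absv (c i \<omega> + s) \<le> \<epsilon> ^ n"
      if "absv (\<sigma> (Y \<omega>) - s) \<le> \<epsilon> ^ n" for \<omega> s
      using absv_add_le[OF _ that, of "c i \<omega> + s"] absv_diff_le[OF _ that, of "c i \<omega> + \<sigma> (Y \<omega>)"]
      by auto
    have "\<omega> \<in> (\<Union>s\<in>S. E s) \<longleftrightarrow> Y \<omega> \<in> Q \<and> absv (c i \<omega> + \<sigma> (Y \<omega>)) \<le> \<epsilon> ^ n"
      if \<omega>: "\<omega> \<in> space M" for \<omega>
      using S(2)[OF \<sigma>_le[OF \<omega>]] iff[of \<omega>] BY[OF \<omega>] \<omega> by (auto simp: E_def)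
    then show ?thesis by (auto simp: E_def)
  qed
  have "M.prob {\<omega> \<in> space M. Y \<omega> \<in> Q \<and> absv (c i \<omega> + \<sigma> (Y \<omega>)) \<le> \<epsilon> ^ n} = (\<Sum>s\<in>S. M.prob (E s))"
    unfolding UE
  proof (rule M.finite_measure_finite_Union[OF S1])
    show "disjoint_family_on E S"
      using disj_F unfolding disjoint_family_on_def E_def F_def by blast
  qed (use E_sets in auto)
  also have "\<dots> = \<epsilon> ^ n * (\<Sum>s\<in>S. M.prob (F s))"
    by (simp add: prob_E sum_distrib_left)
  also have "(\<Sum>s\<in>S. M.prob (F s)) = M.prob {\<omega> \<in> space M. Y \<omega> \<in> Q}"
    unfolding UF using F_sets by (intro M.finite_measure_finite_Union[OF S1 _ disj_F, symmetric]) auto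
  finally show ?thesis unfolding \<sigma>Y unfolding Y_def .
qed

text \<open>A linear form is distributed like its largest coefficient \<open>v\<^sub>k\<close> times a uniform element: after
  division by \<open>v\<^sub>k\<close> its coefficients are integral and \<open>c\<^sub>k\<close> serves as pivot.\<close>

lemma prob_linear_form_le:
  assumes k: "k \<in> {1..t}" "absv (v k) = \<beta>" and \<beta>: "0 < \<beta>"
    and v: "\<And>j. j \<in> {1..t} \<Longrightarrow> absv (v j) \<le> \<beta>"
  shows "M.prob {\<omega> \<in> space M. absv (\<Sum>j=1..t. c j \<omega> * v j) \<le> \<beta> * \<epsilon> ^ n} = \<epsilon> ^ n"
proof -
  define J where "J = {1..t} - {k}"
  have nz: "v k \<noteq> 0" using k \<beta> by auto
  have "absv (\<Sum>j=1..t. c j \<omega> * v j) \<le> \<beta> * \<epsilon> ^ n \<longleftrightarrow>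
      absv (c k \<omega> + (\<Sum>j\<in>J. c j \<omega> * (v j / v k))) \<le> \<epsilon> ^ n" for \<omega>
  proof -
    have "(\<Sum>j=1..t. c j \<omega> * v j) = v k * (c k \<omega> + (\<Sum>j\<in>J. c j \<omega> * (v j / v k)))"
      using nz k by (subst sum.remove[of _ k]) (auto simp: J_def sum_distrib_left algebra_simps)
    then show ?thesis using \<beta> by (simp add: absv_mult k)
  qed
  moreover have "M.prob {\<omega> \<in> space M. restrict (\<lambda>j. c j \<omega>) J \<in> space (Pi\<^sub>M J (\<lambda>_. \<mu>)) \<and>
      absv (c k \<omega> + (\<Sum>j\<in>J. c j \<omega> * (v j / v k))) \<le> \<epsilon> ^ n} =
    \<epsilon> ^ n * M.prob {\<omega> \<in> space M. restrict (\<lambda>j. c j \<omega>) J \<in> space (Pi\<^sub>M J (\<lambda>_. \<mu>))}"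
    using v \<beta> k by (intro prob_pivot) (auto simp: J_def absv_divide)
  moreover have "restrict (\<lambda>j. c j \<omega>) J \<in> space (Pi\<^sub>M J (\<lambda>_. \<mu>))" if "\<omega> \<in> space M" for \<omega>
    using coefficient_measurable(3) that by (auto simp: space_PiM space_Haar J_def)
  ultimately show ?thesis by (simp cong: conj_cong add: M.prob_space)
qed

lemma prob_linear_form_eq:
  assumes k: "k \<in> {1..t}" "absv (v k) = \<epsilon> ^ l"
    and v: "\<And>j. j \<in> {1..t} \<Longrightarrow> absv (v j) \<le> \<epsilon> ^ l"
  shows "M.prob {\<omega> \<in> space M. absv (\<Sum>j=1..t. c j \<omega> * v j) = \<epsilon> ^ m} =
    (if m < l then 0 else (1 - \<epsilon>) * \<epsilon> ^ (m - l))"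
proof -
  let ?X = "\<lambda>\<omega>. \<Sum>j=1..t. c j \<omega> * v j"
  have e: "0 < \<epsilon>" "\<epsilon> < 1" by (fact eps_pos, fact eps_less_1)
  show ?thesis
  proof (cases "m < l")
    case True
    have "absv (?X \<omega>) < \<epsilon> ^ m" if "\<omega> \<in> space M" for \<omega>
    proof -
      have "absv (?X \<omega>) \<le> \<epsilon> ^ l"
        using coefficient_measurable(3)[OF _ that] v e
        by (intro absv_sum_le) (auto simp: absv_mult intro!: mult_left_le_one_le[THEN order_trans])
      also have "\<dots> < \<epsilon> ^ m" using True e by (intro power_strict_decreasing) auto
      finally show ?thesis .
    qed
    then have empty: "{\<omega> \<in> space M. absv (?X \<omega>) = \<epsilon> ^ m} = {}" by force
    show ?thesis unfolding empty using True by simp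
  next
    case False
    then obtain n where n: "m = l + n" by (metis le_Suc_ex not_less)
    have meas: "(\<lambda>\<omega>. absv (?X \<omega>)) \<in> borel_measurable M"
    proof -
      have "?X \<in> borel_measurable M"
        by (intro borel_measurable_sum borel_measurable_mult_const coefficient_measurable(2)) auto
      from borel_measurable_absv_diff[OF this, of 0] show ?thesis by simp
    qed
    \<comment> \<open>Discreteness of the value group writes the sphere as a difference of two balls.\<close>
    have iff: "absv x = \<epsilon> ^ m \<longleftrightarrow> absv x \<le> \<epsilon> ^ m \<and> \<not> absv x \<le> \<epsilon> ^ Suc m" for x :: 'a
    proof
      assume *: "absv x \<le> \<epsilon> ^ m \<and> \<not> absv x \<le> \<epsilon> ^ Suc m"
      then have nz: "x \<noteq> 0" using e by auto
      have le1: "absv x \<le> 1" using * eps_power_le_1[of m] by linarith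
      obtain r where r: "absv x = \<epsilon> ^ r" using value_group_nat[OF nz le1] .
      have "m \<le> r" "r < Suc m"
        using * e unfolding r by (auto simp: power_decreasing_iff simp flip: power_Suc)
      then show "absv x = \<epsilon> ^ m" using r by (simp add: less_Suc_eq_le)
    qed (use e in auto)
    have "M.prob {\<omega> \<in> space M. absv (?X \<omega>) = \<epsilon> ^ m} =
      M.prob ({\<omega> \<in> space M. absv (?X \<omega>) \<le> \<epsilon> ^ m} - {\<omega> \<in> space M. absv (?X \<omega>) \<le> \<epsilon> ^ Suc m})"
      unfolding iff by (rule arg_cong[where f = M.prob]) auto
    also have "\<dots> = M.prob {\<omega> \<in> space M. absv (?X \<omega>) \<le> \<epsilon> ^ m} - M.prob {\<omega> \<in> space M. absv (?X \<omega>) \<le> \<epsilon> ^ Suc m}"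
      using e meas
      by (intro M.finite_measure_Diff borel_measurable_le)
        (auto elim!: order_trans simp: mult_left_le_one_le)
    also have "\<dots> = \<epsilon> ^ n - \<epsilon> ^ Suc n"
      using prob_linear_form_le[of k v "\<epsilon> ^ l" n, OF k _ v]
        prob_linear_form_le[of k v "\<epsilon> ^ l" "Suc n", OF k _ v] e
      by (simp add: n power_add mult.left_commute)
    finally show ?thesis using False by (simp add: n algebra_simps)
  qed
qed

end

section \<open>Expectations of cardinalities of countable disjoint unions\<close>

lemma sums_card_UN:
  fixes A :: "nat \<Rightarrow> 'b set"
  assumes "finite (\<Union>k. A k)" "disjoint_family A"
  shows "(\<lambda>k. real (card (A k))) sums real (card (\<Union>k. A k))"
proof -
  define K where "K = {k. A k \<noteq> {}}"
  define f where "f k = (SOME x. x \<in> A k)" for k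
  have f: "f k \<in> A k" if "k \<in> K" for k
    using that by (simp add: K_def f_def some_in_eq)
  have "inj_on f K"
  proof (rule inj_onI)
    fix k l assume "k \<in> K" "l \<in> K" "f k = f l"
    then have "f k \<in> A k \<inter> A l" using f[of k] f[of l] by simp
    then show "k = l" using assms(2) by (auto simp: disjoint_family_on_def)
  qed
  moreover have "f ` K \<subseteq> (\<Union>k. A k)"
    using f by auto
  ultimately have K: "finite K"
    using finite_imageD finite_subset[OF _ assms(1)] by blast
  have "(\<lambda>k. real (card (A k))) sums (\<Sum>k\<in>K. real (card (A k)))"
    by (rule sums_finite[OF K]) (simp add: K_def)
  moreover have "(\<Sum>k\<in>K. real (card (A k))) = real (card (\<Union>k\<in>K. A k))"
  proof (subst card_UN_disjoint[OF K])
    show "\<forall>k\<in>K. finite (A k)" using finite_subset[OF UN_upper assms(1)] by simp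
    show "\<forall>k\<in>K. \<forall>l\<in>K. k \<noteq> l \<longrightarrow> A k \<inter> A l = {}"
      using assms(2) by (simp add: disjoint_family_on_def)
  qed simp
  moreover have "(\<Union>k\<in>K. A k) = (\<Union>k. A k)" by (auto simp: K_def)
  ultimately show ?thesis by simp
qed

lemma has_bochner_integral_card_UN:
  fixes A :: "nat \<Rightarrow> 'w \<Rightarrow> 'b set"
  assumes int: "\<And>k. has_bochner_integral M (\<lambda>\<omega>. real (card (A k \<omega>))) (e k)"
    and sums: "e sums s"
    and fin: "\<And>\<omega>. \<omega> \<in> space M \<Longrightarrow> finite (\<Union>k. A k \<omega>)"
    and disj: "\<And>\<omega>. \<omega> \<in> space M \<Longrightarrow> disjoint_family (\<lambda>k. A k \<omega>)"
  shows "has_bochner_integral M (\<lambda>\<omega>. real (card (\<Union>k. A k \<omega>))) s"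
proof -
  let ?f = "\<lambda>k \<omega>. real (card (A k \<omega>))"
  have int': "integrable M (?f k)" and eq: "integral\<^sup>L M (?f k) = e k" for k
    using int[of k] by (auto simp: has_bochner_integral_iff)
  have pt: "(\<lambda>k. ?f k \<omega>) sums real (card (\<Union>k. A k \<omega>))" if "\<omega> \<in> space M" for \<omega>
    using sums_card_UN[OF fin disj] that by simp
  have AE: "AE \<omega> in M. summable (\<lambda>k. norm (?f k \<omega>))"
    using pt by (intro AE_I2) (simp add: sums_iff)
  have sm: "summable (\<lambda>k. \<integral>\<omega>. norm (?f k \<omega>) \<partial>M)"
    using sums by (simp add: eq sums_iff)
  have "has_bochner_integral M (\<lambda>\<omega>. \<Sum>k. ?f k \<omega>) s"
    using integrable_suminf[OF int' AE sm] integral_suminf[OF int' AE sm] sums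
    by (simp add: has_bochner_integral_iff eq sums_iff)
  then show ?thesis
    by (rule has_bochner_integral_cong[THEN iffD1, rotated -1]) (use pt in \<open>auto simp: sums_iff\<close>)
qed

section \<open>Expected numbers of zeros on spheres\<close>

context uniformized
begin

text \<open>Put \<open>x = \<pi>\<^sup>k u\<close>. Then \<open>f(x) = x\<^bsup>a\<^sub>i\<^esup> G(u)\<close>, where \<open>G\<close> has exponents \<open>a\<^sub>j - a\<^sub>i\<close> and coefficients
  scaled by \<open>\<pi>\<^bsup>k(a\<^sub>j - a\<^sub>i)\<^esup>\<close>. Differentiating in Euler's form, \<open>x f'(x) = x\<^bsup>a\<^sub>i\<^esup> (u G'(u) + a\<^sub>i G(u))\<close>, so at a
  common zero the two derivatives vanish together.\<close>

lemma nondeg_zeros_sphere: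
  fixes k :: int and d :: "nat \<Rightarrow> 'a"
  shows "nondeg_zeros {x. absv x = \<epsilon> powi k} t a d =
    (*) (\<pi> powi k) ` nondeg_zeros {z. absv z = 1} t (\<lambda>j. a j - a i) (\<lambda>j. d j * \<pi> powi (k * (a j - a i)))"
    (is "_ = _ ` nondeg_zeros _ t ?b ?e")
proof -
  define p where "p = \<pi> powi k"
  have p: "p \<noteq> 0" "absv p = \<epsilon> powi k" "\<epsilon> powi k \<noteq> 0"
    using pi_nonzero eps_pos by (auto simp: p_def absv_pi_powi)
  have euler: "x * laurent_deriv t a d x = (\<Sum>j=1..t. d j * of_int (a j) * x powi a j)"
    if "x \<noteq> 0" for x and a and d :: "nat \<Rightarrow> 'a"
    unfolding laurent_deriv_def sum_distrib_left
  proof (intro sum.cong refl)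
    fix j
    have "x powi a j = x powi (a j - 1) * x" using power_int_minus_mult[of x "a j"] that by simp
    then show "x * (d j * of_int (a j) * x powi (a j - 1)) = d j * of_int (a j) * x powi a j"
      by (simp add: mult_ac)
  qed
  have mono: "(p * u) powi a j = (p * u) powi a i * (\<pi> powi (k * (a j - a i)) * u powi (a j - a i))"
    if "u \<noteq> 0" for u j
  proof -
    have "(p * u) powi a j = (p * u) powi a i * (p * u) powi (a j - a i)"
      using that p power_int_add[of "p * u" "a i" "a j - a i"] by simp
    then show ?thesis by (simp add: power_int_mult_distrib power_int_mult p_def)
  qed
  have eval: "laurent_eval t a d (p * u) = (p * u) powi a i * laurent_eval t ?b ?e u" if "u \<noteq> 0" for u
    unfolding laurent_eval_def sum_distrib_left
    by (intro sum.cong refl, subst mono[OF that]) (simp only: mult_ac)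
  have deriv: "(p * u) * laurent_deriv t a d (p * u) =
      (p * u) powi a i * (u * laurent_deriv t ?b ?e u + of_int (a i) * laurent_eval t ?b ?e u)"
    if "u \<noteq> 0" for u
  proof -
    have *: "u * laurent_deriv t ?b ?e u + of_int (a i) * laurent_eval t ?b ?e u =
        (\<Sum>j=1..t. ?e j * of_int (a j) * u powi ?b j)"
      unfolding euler[OF that] laurent_eval_def sum_distrib_left sum.distrib[symmetric]
      by (intro sum.cong refl) (simp add: algebra_simps)
    have "p * u \<noteq> 0" using that p by simp
    from euler[OF this] show ?thesis
      unfolding * sum_distrib_left
      by (simp only:) (intro sum.cong refl, subst mono[OF that], simp only: mult_ac)
  qed
  have mem: "p * u \<in> nondeg_zeros {x. absv x = \<epsilon> powi k} t a d \<longleftrightarrow>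
      u \<in> nondeg_zeros {z. absv z = 1} t ?b ?e" for u
  proof (cases "absv u = 1")
    case True
    then have u: "u \<noteq> 0" by auto
    then have nz: "(p * u) powi a i \<noteq> 0" using p by simp
    have "laurent_eval t a d (p * u) = 0 \<longleftrightarrow> laurent_eval t ?b ?e u = 0"
      unfolding eval[OF u] mult_eq_0_iff using nz by blast
    moreover have "laurent_deriv t a d (p * u) = 0 \<longleftrightarrow> laurent_deriv t ?b ?e u = 0"
      if "laurent_eval t ?b ?e u = 0"
    proof -
      have eq: "(p * u) * laurent_deriv t a d (p * u) =
          (p * u) powi a i * (u * laurent_deriv t ?b ?e u)"
        unfolding deriv[OF u] that by (simp only: mult_zero_right add_0_right)
      have "laurent_deriv t a d (p * u) = 0 \<longleftrightarrow> (p * u) * laurent_deriv t a d (p * u) = 0"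
        using p u by simp
      also have "\<dots> \<longleftrightarrow> laurent_deriv t ?b ?e u = 0"
        unfolding eq mult_eq_0_iff[of "(p * u) powi a i"] mult_eq_0_iff[of u] using nz u by blast
      finally show ?thesis .
    qed
    ultimately show ?thesis using True p by (auto simp: nondeg_zeros_def absv_mult)
  next
    case False
    then show ?thesis using p by (auto simp: nondeg_zeros_def absv_mult)
  qed
  have "x \<in> nondeg_zeros {x. absv x = \<epsilon> powi k} t a d \<longleftrightarrow>
      x / p \<in> nondeg_zeros {z. absv z = 1} t ?b ?e" for x
    using mem[of "x / p"] p by simp
  moreover have "x \<in> (*) p ` Z \<longleftrightarrow> x / p \<in> Z" for x Z
    using p by (auto intro!: image_eqI[of _ _ "x / p"])
  ultimately show ?thesis by (auto simp flip: p_def)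
qed

end

context uniform_coefficients
begin

lemma combination_measurable:
  assumes "J \<subseteq> {1..t}"
  shows "(\<lambda>\<omega>. absv (\<Sum>j\<in>J. c j \<omega> * v j)) \<in> borel_measurable M"
proof -
  have "(\<lambda>\<omega>. \<Sum>j\<in>J. c j \<omega> * v j) \<in> borel_measurable M"
    using assms by (intro borel_measurable_sum borel_measurable_mult_const coefficient_measurable(2)) auto
  from borel_measurable_absv_diff[OF this, of 0] show ?thesis by simp
qed

text \<open>The zeros are sorted by the absolute value \<open>\<epsilon>\<^sup>m\<close> of the derivative. With \<open>\<beta> = \<epsilon>\<^sup>l\<close>, the class \<open>m\<close>
  contributes \<open>(1 - \<epsilon>) \<epsilon>\<^sup>m\<close> times the probability \<open>p m\<close> that the derivative at a fixed unit has this
  absolute value, which is nonzero only for \<open>m \<ge> l\<close>.\<close>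

lemma expected_unit_zeros:
  assumes b: "strict_mono_on {1..t} b" and i: "i \<in> {1..t}" "b i = 0" "w i = 1"
    and w: "\<And>j. j \<in> {1..t} \<Longrightarrow> absv (w j) \<le> 1"
    and k: "k \<in> {1..t}" "k \<noteq> i" "w k \<noteq> 0" "absv (w k * of_int (b k)) = \<beta>"
    and \<beta>: "\<And>j. j \<in> {1..t} - {i} \<Longrightarrow> absv (w j * of_int (b j)) \<le> \<beta>"
  shows "has_bochner_integral M
    (\<lambda>\<omega>. real (card (nondeg_zeros {z. absv z = 1} t b (\<lambda>j. c j \<omega> * w j)))) ((1 - \<epsilon>) / (1 + \<epsilon>) * \<beta>)"
proof -
  have e: "0 < \<epsilon>" "\<epsilon> < 1" by (fact eps_pos, fact eps_less_1)
  define J where "J = {1..t} - {i}"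
  have "b k \<noteq> b i" 
    using inj_on_eq_iff[OF strict_mono_on_imp_inj_on[OF b] k(1) i(1)] k(2) by simp
  then have nz: "w k * of_int (b k) \<noteq> 0" using k i by simp
  have le1: "absv (w k * of_int (b k)) \<le> 1"
    using w[OF k(1)] absv_of_int_le_1[of "b k", where 'a = 'a] by (simp add: absv_mult mult_le_one)
  obtain l where "absv (w k * of_int (b k)) = \<epsilon> ^ l" using value_group_nat[OF nz le1] .
  then have l: "\<beta> = \<epsilon> ^ l" using k by simp
  let ?G = "\<lambda>\<omega>. laurent_eval t b (\<lambda>j. c j \<omega> * w j)" and ?D = "\<lambda>\<omega>. laurent_deriv t b (\<lambda>j. c j \<omega> * w j)"
  have coeff: "\<forall>j\<in>{1..t}. absv (c j \<omega> * w j) \<le> 1" if "\<omega> \<in> space M" for \<omega>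
    using coefficient_measurable(3)[OF _ that] w by (auto simp: absv_mult intro!: mult_le_one)
  define u where "u x j = w j * of_int (b j) * x powi (b j - 1)" for x j
  have u: "absv (u x j) = absv (w j * of_int (b j))" if "absv x = 1" for x j
    using that by (simp add: u_def absv_mult absv_power_int)
  have D: "?D \<omega> x = (\<Sum>j=1..t. c j \<omega> * u x j)" for \<omega> x
    unfolding laurent_deriv_def u_def by (simp add: mult_ac)
  have DJ: "?D \<omega> x = (\<Sum>j\<in>J. c j \<omega> * u x j)" for \<omega> x
    unfolding D using i by (subst sum.remove[of _ i]) (auto simp: J_def u_def)
  have G: "?G \<omega> x = c i \<omega> + (\<Sum>j\<in>J. c j \<omega> * (w j * x powi b j))" for \<omega> x
    unfolding laurent_eval_def using i by (subst sum.remove[of _ i]) (auto simp: J_def mult_ac)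
  define p where "p m = (if m < l then 0 else (1 - \<epsilon>) * \<epsilon> ^ (m - l))" for m
  define P where "P m x \<omega> \<longleftrightarrow> absv (?D \<omega> x) = \<epsilon> ^ m \<and> absv (?G \<omega> x) \<le> \<epsilon> ^ m * (\<epsilon> ^ m * \<epsilon>)" for m x \<omega>
  have D_meas: "(\<lambda>\<omega>. absv (?D \<omega> x)) \<in> borel_measurable M" for x
    unfolding D by (rule combination_measurable) simp
  have G_meas: "(\<lambda>\<omega>. absv (?G \<omega> x)) \<in> borel_measurable M" for x
    unfolding laurent_eval_def mult.assoc by (rule combination_measurable) simp
  have P_sets: "{\<omega> \<in> space M. P m x \<omega>} \<in> sets M" for m x
    unfolding P_def
    by (intro sets.sets_Collect_conj borel_measurable_eq borel_measurable_le D_meas G_meas) auto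
  have prob_P: "M.prob {\<omega> \<in> space M. P m x \<omega>} = \<epsilon> ^ Suc (m + m) * p m" if x: "absv x = 1" for m x
  proof -
    define Q where "Q = {y \<in> space (Pi\<^sub>M J (\<lambda>_. \<mu>)). absv (\<Sum>j\<in>J. y j * u x j) = \<epsilon> ^ m}"
    have "(\<lambda>y. absv (\<Sum>j\<in>J. y j * u x j)) \<in> borel_measurable (Pi\<^sub>M J (\<lambda>_. \<mu>))"
      using borel_measurable_absv_diff[OF linear_form_measurable[of J "u x"], of 0] by (auto simp: J_def)
    then have Q: "Q \<in> sets (Pi\<^sub>M J (\<lambda>_. \<mu>))"
      unfolding Q_def by (intro borel_measurable_eq) auto
    have Qiff: "restrict (\<lambda>j. c j \<omega>) J \<in> Q \<longleftrightarrow> absv (?D \<omega> x) = \<epsilon> ^ m" if "\<omega> \<in> space M" for \<omega>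
    proof -
      have "restrict (\<lambda>j. c j \<omega>) J \<in> space (Pi\<^sub>M J (\<lambda>_. \<mu>))"
        using coefficient_measurable(3)[OF _ that] by (auto simp: space_PiM space_Haar J_def)
      moreover have "(\<Sum>j\<in>J. restrict (\<lambda>j. c j \<omega>) J j * u x j) = (\<Sum>j\<in>J. c j \<omega> * u x j)"
        by (intro sum.cong) auto
      ultimately show ?thesis unfolding Q_def DJ by simp
    qed
    \<comment> \<open>The slope condition is an event \<open>Q\<close> about the coefficients other than the pivot.\<close>
    have "\<epsilon> ^ m * (\<epsilon> ^ m * \<epsilon>) = \<epsilon> ^ Suc (m + m)" by (simp add: power_add mult_ac)
    then have "P m x \<omega> \<longleftrightarrow> restrict (\<lambda>j. c j \<omega>) J \<in> Q \<and>
        absv (c i \<omega> + (\<Sum>j\<in>J. c j \<omega> * (w j * x powi b j))) \<le> \<epsilon> ^ Suc (m + m)"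
      if "\<omega> \<in> space M" for \<omega>
      unfolding P_def G Qiff[OF that] by (simp only:)
    then have "{\<omega> \<in> space M. P m x \<omega>} = {\<omega> \<in> space M. restrict (\<lambda>j. c j \<omega>) J \<in> Q \<and>
        absv (c i \<omega> + (\<Sum>j\<in>J. c j \<omega> * (w j * x powi b j))) \<le> \<epsilon> ^ Suc (m + m)}"
      by blast
    also have "M.prob \<dots> = \<epsilon> ^ Suc (m + m) * M.prob {\<omega> \<in> space M. restrict (\<lambda>j. c j \<omega>) J \<in> Q}"
      using w x by (intro prob_pivot i Q) (auto simp: J_def absv_mult absv_power_int)
    also have "{\<omega> \<in> space M. restrict (\<lambda>j. c j \<omega>) J \<in> Q} =
        {\<omega> \<in> space M. absv (\<Sum>j=1..t. c j \<omega> * u x j) = \<epsilon> ^ m}"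
      using Qiff unfolding D by blast
    also have "M.prob \<dots> = p m"
      unfolding p_def
    proof (rule prob_linear_form_eq[OF k(1)])
      show "absv (u x k) = \<epsilon> ^ l" using u[OF x, of k] k l by simp
      show "absv (u x j) \<le> \<epsilon> ^ l" if "j \<in> {1..t}" for j
        using u[OF x, of j] \<beta>[of j] that l e i by (cases "j = i") auto
    qed
    finally show ?thesis .
  qed
  define A where "A m \<omega> = {z. absv z = 1 \<and> ?G \<omega> z = 0 \<and> absv (?D \<omega> z) = \<epsilon> ^ m}" for m \<omega>
  have A_int: "has_bochner_integral M (\<lambda>\<omega>. real (card (A m \<omega>))) ((1 - \<epsilon>) * \<epsilon> ^ m * p m)" for m
  proof -
    obtain S :: "'a set" where S: "finite S" "real (card S) = (1 - \<epsilon>) / \<epsilon> ^ Suc m"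
      "\<And>s. s \<in> S \<Longrightarrow> absv s = 1"
      "\<And>z. absv z = 1 \<Longrightarrow> \<exists>!s. s \<in> S \<and> absv (z - s) \<le> \<epsilon> ^ Suc m"
      using unit_representatives by blast
    have S4: "\<exists>!s. s \<in> S \<and> absv (z - s) \<le> \<epsilon> ^ m * \<epsilon>" if "absv z = 1" for z
      using S(4)[OF that] by (simp add: mult.commute)
    have "has_bochner_integral M (\<lambda>\<omega>. \<Sum>x\<in>S. indicator {\<omega> \<in> space M. P m x \<omega>} \<omega> :: real)
        (\<Sum>x\<in>S. M.prob {\<omega> \<in> space M. P m x \<omega>})"
      using P_sets by (intro has_bochner_integral_sum has_bochner_integral_real_indicator)
        (auto simp: M.emeasure_eq_measure)
    also have "(\<Sum>x\<in>S. M.prob {\<omega> \<in> space M. P m x \<omega>}) = real (card S) * (\<epsilon> ^ Suc (m + m) * p m)"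
      using S(3) by (simp add: prob_P)
    also have "\<dots> = (1 - \<epsilon>) * \<epsilon> ^ m * p m"
      unfolding S(2) using e by (simp add: power_add)
    finally show ?thesis
    proof (rule has_bochner_integral_cong[THEN iffD1, rotated -1])
      fix \<omega> assume \<omega>: "\<omega> \<in> space M"
      have "card (A m \<omega>) = card {x \<in> S. P m x \<omega>}"
        unfolding A_def P_def using e eps_power_le_1
        by (intro card_unit_zeros_of_slope[OF coeff[OF \<omega>] _ _ _ _ S(3) S4]) auto
      also have "real \<dots> = (\<Sum>x\<in>S. indicator {\<omega> \<in> space M. P m x \<omega>} \<omega>)"
        using S(1) \<omega> by (simp add: indicator_def sum.If_cases Int_def)
      finally show "(\<Sum>x\<in>S. indicator {\<omega> \<in> space M. P m x \<omega>} \<omega>) = real (card (A m \<omega>))" by simp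
    qed auto
  qed
  have UA: "(\<Union>m. A m \<omega>) = nondeg_zeros {z. absv z = 1} t b (\<lambda>j. c j \<omega> * w j)" if "\<omega> \<in> space M" for \<omega>
  proof (intro subset_antisym subsetI)
    fix z assume "z \<in> (\<Union>m. A m \<omega>)"
    then show "z \<in> nondeg_zeros {z. absv z = 1} t b (\<lambda>j. c j \<omega> * w j)"
      using e by (auto simp: A_def nondeg_zeros_def)
  next
    fix z assume z: "z \<in> nondeg_zeros {z. absv z = 1} t b (\<lambda>j. c j \<omega> * w j)"
    then have "?D \<omega> z \<noteq> 0" "absv (?D \<omega> z) \<le> 1"
      using laurent_deriv_le_1[OF _ coeff[OF that]] by (auto simp: nondeg_zeros_def)
    then obtain m where "absv (?D \<omega> z) = \<epsilon> ^ m" by (rule value_group_nat)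
    then show "z \<in> (\<Union>m. A m \<omega>)" using z by (auto simp: A_def nondeg_zeros_def)
  qed
  have "(\<lambda>n. (1 - \<epsilon>)\<^sup>2 * \<epsilon> ^ l * (\<epsilon>\<^sup>2) ^ n) sums ((1 - \<epsilon>)\<^sup>2 * \<epsilon> ^ l * (1 / (1 - \<epsilon>\<^sup>2)))"
    using e by (intro sums_mult geometric_sums) (simp add: power_less_one_iff)
  also have "(1 - \<epsilon>)\<^sup>2 * \<epsilon> ^ l * (1 / (1 - \<epsilon>\<^sup>2)) = (1 - \<epsilon>) / (1 + \<epsilon>) * \<beta>"
  proof -
    have "1 - \<epsilon>\<^sup>2 = (1 - \<epsilon>) * (1 + \<epsilon>)" by (simp add: power2_eq_square algebra_simps)
    then show ?thesis using e l by (simp add: power2_eq_square)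
  qed
  also have "(\<lambda>n. (1 - \<epsilon>)\<^sup>2 * \<epsilon> ^ l * (\<epsilon>\<^sup>2) ^ n) = (\<lambda>n. (1 - \<epsilon>) * \<epsilon> ^ (n + l) * p (n + l))"
    by (simp add: p_def fun_eq_iff power_add power2_eq_square power_mult_distrib mult_ac)
  finally have "(\<lambda>m. (1 - \<epsilon>) * \<epsilon> ^ m * p m) sums ((1 - \<epsilon>) / (1 + \<epsilon>) * \<beta>)"
    by (subst (asm) sums_zero_iff_shift) (simp_all add: p_def)
  then have "has_bochner_integral M (\<lambda>\<omega>. real (card (\<Union>m. A m \<omega>))) ((1 - \<epsilon>) / (1 + \<epsilon>) * \<beta>)"
  proof (rule has_bochner_integral_card_UN[OF A_int])
    show "finite (\<Union>m. A m \<omega>)" if "\<omega> \<in> space M" for \<omega>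
      unfolding UA[OF that] by (rule finite_nondeg_zeros[OF b]) simp
    show "disjoint_family (\<lambda>m. A m \<omega>)" for \<omega>
      using e powi_eps_inj[of "int m" "int n" for m n] by (auto simp: disjoint_family_on_def A_def)
  qed
  then show ?thesis
    by (rule has_bochner_integral_cong[THEN iffD1, rotated -1]) (simp_all add: UA)
qed

text \<open>The absolute value of the largest coefficient of the derivative on the sphere \<open>|x| = \<epsilon>\<^sup>k\<close>, after
  rescaling to the unit sphere with pivot \<open>i\<close>.\<close>

definition slope_max :: "(nat \<Rightarrow> int) \<Rightarrow> nat \<Rightarrow> int \<Rightarrow> real" where
  "slope_max a i k = Max ((\<lambda>j. \<epsilon> powi (k * (a j - a i)) * absv (of_int (a j - a i) :: 'a)) ` ({1..t} - {i}))"

text \<open>The sign condition on \<open>k\<close> makes the rescaled coefficients integral.\<close>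

lemma expected_sphere_zeros:
  assumes t: "2 \<le> t" and a: "strict_mono_on {1..t} a" and i: "i \<in> {1..t}"
    and k: "\<And>j. j \<in> {1..t} \<Longrightarrow> 0 \<le> k * (a j - a i)"
  shows "has_bochner_integral M
    (\<lambda>\<omega>. real (card (nondeg_zeros {x. absv x = \<epsilon> powi k} t a (\<lambda>j. c j \<omega>))))
    ((1 - \<epsilon>) / (1 + \<epsilon>) * slope_max a i k)"
proof -
  let ?w = "\<lambda>j. \<pi> powi (k * (a j - a i))" and ?b = "\<lambda>j. a j - a i"
  let ?f = "\<lambda>j. \<epsilon> powi (k * (a j - a i)) * absv (of_int (a j - a i) :: 'a)"
  have e: "0 < \<epsilon>" "\<epsilon> < 1" by (fact eps_pos, fact eps_less_1)
  have f: "absv (?w j * of_int (?b j)) = ?f j" for j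
    unfolding absv_mult absv_pi_powi ..
  have "(if i = 1 then 2 else 1) \<in> {1..t} - {i}" using t by auto
  then have "{1..t} - {i} \<noteq> {}" by blast
  then have "slope_max a i k \<in> ?f ` ({1..t} - {i})"
    unfolding slope_max_def by (intro Max_in) auto
  then obtain m where m: "m \<in> {1..t} - {i}" "slope_max a i k = ?f m" by blast
  have "has_bochner_integral M
      (\<lambda>\<omega>. real (card (nondeg_zeros {z. absv z = 1} t ?b (\<lambda>j. c j \<omega> * ?w j))))
      ((1 - \<epsilon>) / (1 + \<epsilon>) * slope_max a i k)"
  proof (rule expected_unit_zeros[where i = i and k = m])
    show "strict_mono_on {1..t} ?b" using a by (auto simp: strict_mono_on_def)
    show "absv (?w j) \<le> 1" if "j \<in> {1..t}" for j
      unfolding absv_pi_powi using k[OF that] e by (intro power_int_le_one) auto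
    show "absv (?w j * of_int (?b j)) \<le> slope_max a i k" if "j \<in> {1..t} - {i}" for j
      unfolding f slope_max_def using that by (intro Max_ge) auto
    show "absv (?w m * of_int (?b m)) = slope_max a i k" unfolding f m(2) ..
  qed (use m i pi_nonzero in auto)
  moreover have "card (nondeg_zeros {x. absv x = \<epsilon> powi k} t a d) =
      card (nondeg_zeros {z. absv z = 1} t ?b (\<lambda>j. d j * ?w j))" for d
    unfolding nondeg_zeros_sphere[of k t a d i]
    using pi_nonzero by (intro card_image) (auto simp: inj_on_def)
  ultimately show ?thesis by simp
qed

text \<open>One statement for both sides of the unit sphere: \<open>\<sigma> = 1\<close> with the first exponent as pivot covers
  \<open>0 < |x| < 1\<close>, and \<open>\<sigma> = -1\<close> with the last one covers \<open>|x| > 1\<close>. The index \<open>i'\<close> is the neighbour of the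
  pivot and \<open>D\<close> the gap between the two. The sphere of index \<open>n + 1\<close> contributes at most
  \<open>\<epsilon>\<^bsup>(n+1)D\<^esup> (1 - \<epsilon>) / (1 + \<epsilon>)\<close>, and exactly that if the gap is a unit.\<close>

lemma expected_zeros_one_side:
  fixes \<sigma> D :: int
  assumes t: "2 \<le> t" and a: "strict_mono_on {1..t} a" and \<sigma>: "\<sigma> \<noteq> 0" and D: "0 < D"
    and i: "i \<in> {1..t}" and i': "i' \<in> {1..t} - {i}" "\<sigma> * (a i' - a i) = D"
    and gap: "\<And>j. j \<in> {1..t} - {i} \<Longrightarrow> D \<le> \<sigma> * (a j - a i)"
  obtains r where
    "has_bochner_integral M (\<lambda>\<omega>. real (card (nondeg_zeros
      (\<Union>n. {x. absv x = \<epsilon> powi (\<sigma> * int (Suc n))}) t a (\<lambda>j. c j \<omega>)))) r"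
    "r \<le> (1 - \<epsilon>) / (1 + \<epsilon>) * (inverse (1 - \<epsilon> powi D) - 1)"
    "absv (of_int (a i' - a i) :: 'a) = 1 \<Longrightarrow>
      r = (1 - \<epsilon>) / (1 + \<epsilon>) * (inverse (1 - \<epsilon> powi D) - 1)"
proof -
  define C where "C = (1 - \<epsilon>) / (1 + \<epsilon>)"
  define q where "q = \<epsilon> powi D"
  define s where "s n = slope_max a i (\<sigma> * int (Suc n))" for n
  have e: "0 < \<epsilon>" "\<epsilon> < 1" by (fact eps_pos, fact eps_less_1)
  then have C: "0 \<le> C" by (simp add: C_def)
  have q: "0 < q" "q < 1"
    using e D power_int_strict_decreasing[of 0 D \<epsilon>] by (auto simp: q_def)
  have qn: "\<epsilon> powi (int n * D) = q ^ n" for n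
    by (simp add: q_def mult.commute[of "int n"] power_int_mult)
  let ?f = "\<lambda>n j. \<epsilon> powi (\<sigma> * int (Suc n) * (a j - a i)) * absv (of_int (a j - a i) :: 'a)"
  have f_le: "?f n j \<le> q ^ Suc n" if "j \<in> {1..t} - {i}" for n j
  proof -
    have "int (Suc n) * D \<le> int (Suc n) * (\<sigma> * (a j - a i))"
      by (rule mult_left_mono[OF gap[OF that]]) simp
    then have "\<epsilon> powi (\<sigma> * int (Suc n) * (a j - a i)) \<le> \<epsilon> powi (int (Suc n) * D)"
      using e by (intro power_int_decreasing) (auto simp: mult_ac)
    then have "?f n j \<le> \<epsilon> powi (int (Suc n) * D) * 1"
      using e by (intro mult_mono absv_of_int_le_1) auto
    then show ?thesis unfolding qn by simp
  qed
  have s_le: "s n \<le> q ^ Suc n" for n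
    unfolding s_def slope_max_def
  proof (rule Max.boundedI)
    show "y \<le> q ^ Suc n" if "y \<in> ?f n ` ({1..t} - {i})" for y using that f_le by blast
  qed (use i' in auto)
  have s_nonneg: "0 \<le> s n" for n
  proof -
    have "0 \<le> ?f n i'" using e by simp
    also have "\<dots> \<le> s n" unfolding s_def slope_max_def using i' by (intro Max_ge) auto
    finally show ?thesis .
  qed
  have s_eq: "s n = q ^ Suc n" if "absv (of_int (a i' - a i) :: 'a) = 1" for n
  proof (rule antisym[OF s_le])
    have *: "\<sigma> * int (Suc n) * (a i' - a i) = int (Suc n) * D" unfolding i'(2)[symmetric] by (simp only: mult_ac)
    have "q ^ Suc n = ?f n i'" unfolding * that qn by simp
    also have "\<dots> \<le> s n" unfolding s_def slope_max_def using i' by (intro Max_ge) auto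
    finally show "q ^ Suc n \<le> s n" .
  qed
  have geo: "(\<lambda>n. C * q ^ Suc n) sums (C * (inverse (1 - q) - 1))"
  proof -
    have "(\<lambda>n. q * q ^ n) sums (q * (1 / (1 - q)))"
      using q by (intro sums_mult geometric_sums) simp
    moreover have "q * (1 / (1 - q)) = inverse (1 - q) - 1" using q by (simp add: field_simps)
    ultimately show ?thesis by (intro sums_mult) simp
  qed
  have sm: "summable (\<lambda>n. C * s n)"
    using s_le s_nonneg C
    by (intro summable_comparison_test'[OF sums_summable[OF geo], of 0])
      (simp add: mult_left_mono)
  have disj: "disjoint_family (\<lambda>n. nondeg_zeros {x. absv x = \<epsilon> powi (\<sigma> * int (Suc n))} t a d)" for d
    using \<sigma> by (auto simp: disjoint_family_on_def nondeg_zeros_def powi_eps_inj simp del: of_nat_Suc)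
  have UN: "(\<Union>n. nondeg_zeros (U n) t a d) = nondeg_zeros (\<Union>n. U n) t a d" for U :: "nat \<Rightarrow> 'a set" and d
    by (auto simp: nondeg_zeros_def)
  have nz: "0 \<notin> (\<Union>n. {x::'a. absv x = \<epsilon> powi (\<sigma> * int (Suc n))})" using e by auto
  show thesis
  proof (rule that)
    have "has_bochner_integral M (\<lambda>\<omega>. real (card (\<Union>n.
        nondeg_zeros {x. absv x = \<epsilon> powi (\<sigma> * int (Suc n))} t a (\<lambda>j. c j \<omega>)))) (\<Sum>n. C * s n)"
    proof (rule has_bochner_integral_card_UN[OF _ summable_sums[OF sm] _ disj])
      show "has_bochner_integral M (\<lambda>\<omega>. real (card (
          nondeg_zeros {x. absv x = \<epsilon> powi (\<sigma> * int (Suc n))} t a (\<lambda>j. c j \<omega>)))) (C * s n)" for n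
        unfolding C_def s_def
      proof (rule expected_sphere_zeros[OF t a i])
        fix j assume j: "j \<in> {1..t}"
        have "0 \<le> \<sigma> * (a j - a i)" using gap[of j] j D by (cases "j = i") auto
        then have "0 \<le> int (Suc n) * (\<sigma> * (a j - a i))" by simp
        then show "0 \<le> \<sigma> * int (Suc n) * (a j - a i)" by (simp only: mult_ac)
      qed
      show "finite (\<Union>n. nondeg_zeros {x. absv x = \<epsilon> powi (\<sigma> * int (Suc n))} t a (\<lambda>j. c j \<omega>))" for \<omega>
        unfolding UN by (rule finite_nondeg_zeros[OF a nz])
    qed
    then show "has_bochner_integral M (\<lambda>\<omega>. real (card (nondeg_zeros
        (\<Union>n. {x. absv x = \<epsilon> powi (\<sigma> * int (Suc n))}) t a (\<lambda>j. c j \<omega>)))) (\<Sum>n. C * s n)"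
      unfolding UN .
    have "(\<Sum>n. C * s n) \<le> (\<Sum>n. C * q ^ Suc n)"
      using s_le C by (intro suminf_le sm sums_summable[OF geo] mult_left_mono) auto
    then show "(\<Sum>n. C * s n) \<le> (1 - \<epsilon>) / (1 + \<epsilon>) * (inverse (1 - \<epsilon> powi D) - 1)"
      using geo by (simp add: sums_iff C_def q_def)
    show "(\<Sum>n. C * s n) = (1 - \<epsilon>) / (1 + \<epsilon>) * (inverse (1 - \<epsilon> powi D) - 1)"
      if "absv (of_int (a i' - a i) :: 'a) = 1"
      using geo s_eq[OF that] by (simp add: sums_iff C_def q_def)
  qed
qed

end

section \<open>Expected numbers of zeros on the units, the maximal ideal and the field\<close>

theorem theorem7p2p2:
  fixes M :: "'w measure"
    and \<mu> :: "'a::nonarch_local_field_0 measure"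
    and t :: nat
    and a :: "nat \<Rightarrow> int"
    and c :: "nat \<Rightarrow> 'w \<Rightarrow> 'a"
    and \<epsilon> :: real
    and N :: "'a set \<Rightarrow> 'w \<Rightarrow> real"
  assumes "t \<ge> 2"
    and "strict_mono_on {1..t} a"
    and "prob_space M"
    and "normalized_Haar_measure \<mu>"
    and "iid_uniform M {1..t} c \<mu>"
    and "\<epsilon> = 1 / real (residue_card TYPE('a))"
    and "\<And>U \<omega>. N U \<omega> = real (num_nondeg_zeros U t a (\<lambda>j. c j \<omega>))"
  shows
    "integrable M (N valuation_ring_units) \<and>
     integral\<^sup>L M (N valuation_ring_units) =
       (1 - \<epsilon>) / (1 + \<epsilon>) * (MAX j\<in>{2..t}. absv (of_int (a j - a 1) :: 'a)) \<and>
     integrable M (N (maximal_ideal - {0})) \<and>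
     integral\<^sup>L M (N (maximal_ideal - {0})) \<le>
       (1 - \<epsilon>) / (1 + \<epsilon>) * (inverse (1 - \<epsilon> powi (a 2 - a 1)) - 1) \<and>
     (absv (of_int (a 2 - a 1) :: 'a) = 1 \<longrightarrow>
       integral\<^sup>L M (N (maximal_ideal - {0})) =
         (1 - \<epsilon>) / (1 + \<epsilon>) * (inverse (1 - \<epsilon> powi (a 2 - a 1)) - 1)) \<and>
     integrable M (N (UNIV - {0})) \<and>
     integral\<^sup>L M (N (UNIV - {0})) \<le>
       (1 - \<epsilon>) / (1 + \<epsilon>) *
         (inverse (1 - \<epsilon> powi (a 2 - a 1)) + inverse (1 - \<epsilon> powi (a t - a (t - 1))) - 1) \<and>
     (absv (of_int (a 2 - a 1) :: 'a) = 1 \<and> absv (of_int (a t - a (t - 1)) :: 'a) = 1 \<longrightarrow>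
       integral\<^sup>L M (N (UNIV - {0})) =
         (1 - \<epsilon>) / (1 + \<epsilon>) *
           (inverse (1 - \<epsilon> powi (a 2 - a 1)) + inverse (1 - \<epsilon> powi (a t - a (t - 1))) - 1)) \<and>
     integral\<^sup>L M (N (UNIV - {0})) \<le> 1"
proof -
  note t = assms(1) and a = assms(2)
  obtain \<pi> :: 'a where "uniformized \<pi> (absv \<pi>)" using ex_uniformized by blast
  moreover have "\<epsilon> = absv \<pi>"
    using uniformized.eps_residue_card[OF calculation] assms(6) by simp
  ultimately have "uniformized \<pi> \<epsilon>" by simp
  then interpret uniform_coefficients \<pi> \<epsilon> \<mu> M c t
    using assms(3-5)
    by (simp add: uniform_coefficients_def uniformized_Haar_def uniformized_Haar_axioms_def
        uniform_coefficients_axioms_def)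
  have e: "0 < \<epsilon>" "\<epsilon> < 1" by (fact eps_pos, fact eps_less_1)
  define C where "C = (1 - \<epsilon>) / (1 + \<epsilon>)"
  define B where "B = (MAX j\<in>{2..t}. absv (of_int (a j - a 1) :: 'a))"
  have C: "0 \<le> C" using e by (simp add: C_def)
  have N: "N U = (\<lambda>\<omega>. real (card (nondeg_zeros U t a (\<lambda>j. c j \<omega>))))" for U
    by (simp add: fun_eq_iff assms(7) num_nondeg_zeros_def)
  have mono: "a j < a l" if "1 \<le> j" "j < l" "l \<le> t" for j l
    using strict_mono_onD[OF a, of j l] that by simp
  have mono': "a j \<le> a l" if "1 \<le> j" "j \<le> l" "l \<le> t" for j l
    using mono[of j l] that by (cases "j = l") auto

  define Out :: "'a set" where "Out = (\<Union>n. {x. absv x = \<epsilon> powi (- 1 * int (Suc n))})"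
  have le0: "absv x \<le> 0 \<longleftrightarrow> x = 0" for x :: 'a by (simp add: not_less[symmetric])
  have units: "valuation_ring_units = {x::'a. absv x = \<epsilon> powi 0}"
    by (auto simp: valuation_ring_units_def valuation_ring_def inverse_le_1_iff le0)
  have ideal: "maximal_ideal - {0} = (\<Union>n. {x::'a. absv x = \<epsilon> powi (1 * int (Suc n))})"
  proof (intro set_eqI iffI)
    fix x :: 'a assume x: "x \<in> maximal_ideal - {0}"
    then obtain m where m: "absv x = \<epsilon> ^ m" using value_group_nat[of x] by (auto simp: maximal_ideal_def)
    then obtain n where "m = Suc n" using x by (cases m) (auto simp: maximal_ideal_def)
    then show "x \<in> (\<Union>n. {x::'a. absv x = \<epsilon> powi (1 * int (Suc n))})"
      using m by (auto simp del: of_nat_Suc)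
  next
    fix x :: 'a assume "x \<in> (\<Union>n. {x::'a. absv x = \<epsilon> powi (1 * int (Suc n))})"
    then obtain n where "absv x = \<epsilon> ^ Suc n" by (auto simp del: of_nat_Suc power_Suc)
    moreover have "\<epsilon> ^ Suc n < 1" "0 < \<epsilon> ^ Suc n" using e power_Suc_less_one by auto
    ultimately show "x \<in> maximal_ideal - {0}" by (auto simp: maximal_ideal_def)
  qed
  have out: "Out = {x. 1 < absv x}"
  proof (intro set_eqI iffI)
    fix x :: 'a assume "x \<in> {x. 1 < absv x}"
    then have x: "1 < absv x" by simp
    then have "inverse x \<in> maximal_ideal - {0}" by (auto simp: maximal_ideal_def inverse_less_1_iff)
    then obtain n where "absv (inverse x) = \<epsilon> powi int (Suc n)" unfolding ideal by auto
    moreover have "absv x = inverse (absv (inverse x))" by simp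
    ultimately have "absv x = \<epsilon> powi (- 1 * int (Suc n))"
      by (simp only: mult_minus1 power_int_minus)
    then show "x \<in> Out" unfolding Out_def by blast
  next
    fix x :: 'a assume "x \<in> Out"
    then obtain n where x: "absv x = inverse (\<epsilon> ^ Suc n)"
      by (auto simp: Out_def power_int_minus simp del: of_nat_Suc power_Suc)
    have "\<epsilon> ^ Suc n < 1" "0 < \<epsilon> ^ Suc n" using e power_Suc_less_one by auto
    then show "x \<in> {x. 1 < absv x}" unfolding x mem_Collect_eq by (rule one_less_inverse[rotated])
  qed

  have hb0: "has_bochner_integral M (N valuation_ring_units) (C * B)"
  proof -
    have "{1..t} - {1} = {2..t}" by auto
    then have "slope_max a 1 0 = B" by (simp add: slope_max_def B_def)
    then show ?thesis
      using expected_sphere_zeros[OF t a, of 1 0] t unfolding N units C_def by simp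
  qed
  have i1: "(2::nat) \<in> {1..t} - {1}" "(t - 1) \<in> {1..t} - {t}" using t by auto
  obtain r1 where r1: "has_bochner_integral M (N (maximal_ideal - {0})) r1"
    "r1 \<le> C * (inverse (1 - \<epsilon> powi (a 2 - a 1)) - 1)"
    "absv (of_int (a 2 - a 1) :: 'a) = 1 \<Longrightarrow> r1 = C * (inverse (1 - \<epsilon> powi (a 2 - a 1)) - 1)"
  proof (rule expected_zeros_one_side[OF t a, where \<sigma> = 1 and i = 1 and i' = 2 and D = "a 2 - a 1"])
    show "a 2 - a 1 \<le> 1 * (a j - a 1)" if "j \<in> {1..t} - {1}" for j
      using mono'[of 2 j] that by simp
  qed (use t i1 mono[of 1 2] in \<open>auto simp: N ideal C_def\<close>)
  obtain r2 where r2: "has_bochner_integral M (N Out) r2"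
    "r2 \<le> C * (inverse (1 - \<epsilon> powi (a t - a (t - 1))) - 1)"
    "absv (of_int (a (t - 1) - a t) :: 'a) = 1 \<Longrightarrow>
      r2 = C * (inverse (1 - \<epsilon> powi (a t - a (t - 1))) - 1)"
  proof (rule expected_zeros_one_side[OF t a, where \<sigma> = "-1" and i = t and i' = "t - 1" and D = "a t - a (t - 1)"])
    show "a t - a (t - 1) \<le> - 1 * (a j - a t)" if "j \<in> {1..t} - {t}" for j
    proof -
      have "1 \<le> j" "j \<le> t - 1" using that by auto
      then show ?thesis using mono'[of j "t - 1"] by simp
    qed
  qed (use t i1 mono[of "t - 1" t] in \<open>auto simp: N Out_def C_def\<close>)
  have sum: "N (UNIV - {0}) = (\<lambda>\<omega>. N valuation_ring_units \<omega> + N (maximal_ideal - {0}) \<omega> + N Out \<omega>)"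
  proof
    fix \<omega>
    let ?Z = "\<lambda>U. nondeg_zeros U t a (\<lambda>j. c j \<omega>)"
    have Z: "?Z (UNIV - {0}) = ?Z valuation_ring_units \<union> ?Z (maximal_ideal - {0}) \<union> ?Z Out"
      unfolding out units by (auto simp: nondeg_zeros_def maximal_ideal_def)
    have fin: "finite (?Z valuation_ring_units)" "finite (?Z (maximal_ideal - {0}))" "finite (?Z Out)"
      unfolding out units by (auto intro!: finite_nondeg_zeros[OF a])
    have disj: "?Z valuation_ring_units \<inter> ?Z (maximal_ideal - {0}) = {}"
      "(?Z valuation_ring_units \<union> ?Z (maximal_ideal - {0})) \<inter> ?Z Out = {}"
      unfolding out units by (auto simp: nondeg_zeros_def maximal_ideal_def)
    show "N (UNIV - {0}) \<omega> = N valuation_ring_units \<omega> + N (maximal_ideal - {0}) \<omega> + N Out \<omega>"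
      unfolding N Z using fin disj by (simp add: card_Un_disjoint)
  qed
  have hb: "has_bochner_integral M (N (UNIV - {0})) (C * B + r1 + r2)"
    unfolding sum by (intro has_bochner_integral_add hb0 r1(1) r2(1))

  have B_le: "B \<le> 1" unfolding B_def using t by (intro Max.boundedI) (auto simp: absv_of_int_le_1 simp del: of_int_diff)
  have B_eq: "B = 1" if "absv (of_int (a 2 - a 1) :: 'a) = 1"
  proof (rule antisym[OF B_le])
    have "absv (of_int (a 2 - a 1) :: 'a) \<le> B" unfolding B_def using t by (intro Max_ge) auto
    then show "1 \<le> B" using that by simp
  qed
  let ?X = "inverse (1 - \<epsilon> powi (a 2 - a 1))" and ?Y = "inverse (1 - \<epsilon> powi (a t - a (t - 1)))"
  have CB: "C * B \<le> C" using C B_le by (simp add: mult_left_le)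
  have total: "C * B + r1 + r2 \<le> C * (?X + ?Y - 1)"
    using CB r1(2) r2(2) by (simp add: algebra_simps)
  have total_eq: "C * B + r1 + r2 = C * (?X + ?Y - 1)"
    if "absv (of_int (a 2 - a 1) :: 'a) = 1" "absv (of_int (a t - a (t - 1)) :: 'a) = 1"
  proof -
    have "absv (of_int (a (t - 1) - a t) :: 'a) = 1"
      using that(2) absv_minus_commute[of "of_int (a t) :: 'a" "of_int (a (t - 1))"] by simp
    then show ?thesis using r1(3)[OF that(1)] r2(3) B_eq[OF that(1)] by (simp add: algebra_simps)
  qed
  have gap: "inverse (1 - \<epsilon> powi d) \<le> inverse (1 - \<epsilon>)" if "0 < d" for d
  proof -
    have "\<epsilon> powi d \<le> \<epsilon> powi 1" using e that by (intro power_int_decreasing) auto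
    then show ?thesis using e by (intro le_imp_inverse_le) auto
  qed
  have "?X + ?Y - 1 \<le> inverse (1 - \<epsilon>) + inverse (1 - \<epsilon>) - 1"
    using gap[of "a 2 - a 1"] gap[of "a t - a (t - 1)"] mono[of 1 2] mono[of "t - 1" t] t by simp
  then have "C * (?X + ?Y - 1) \<le> C * (inverse (1 - \<epsilon>) + inverse (1 - \<epsilon>) - 1)"
    using C by (rule mult_left_mono)
  also have "\<dots> = 1"
  proof -
    have "1 - \<epsilon> \<noteq> 0" "1 + \<epsilon> \<noteq> 0" using e by auto
    then show ?thesis by (simp add: C_def divide_simps)
  qed
  finally have le1: "C * (?X + ?Y - 1) \<le> 1" .
  show ?thesis
    using hb0 r1 hb total total_eq le1
    unfolding has_bochner_integral_iff B_def[symmetric] C_def[symmetric] by auto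
qed

end
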